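(* Let $S$ be a set with $|S| = n$, let $q \sim \mathcal{U}([n]^{S\times\{0,1\}})$, and let $G_q$ be the multigraph on node set $[n]$ with one edge $\{q(j,0), q(j,1)\}$ for each $j \in S$. Define $A \in \mathbb{F}_2^{n \times S}$ by $A_{i,j} = 1$ if and only if exactly one of $q(j,0) = i$ and $q(j,1) = i$ holds, and $d \in \mathbb{F}_2^n$ by $d_i = |\{ j \in S : q(j,0) = i\}| + 1 \pmod 2$. Let $b = \lceil n - \tfrac{1}{9}\ln(n) \rceil$ and let $H \sim \mathcal{U}(\mathbb{F}_2^{S \times b})$ be independent of $q$. Then $$\mathbb{P}[\exists x \in \mathbb{F}_2^b : AHx = d \mid G_q \text{ is a pseudoforest}] \in \Omega_{n\to\infty}(1).$$
   Context: $[n]=\{1,\ldots,n\}$; $\mathcal{U}(X)$ is the uniform distribution on $X$. Loops and multiple edges are allowed in $G_q$. A pseudoforest is a multigraph in which every connected component contains exactly one cycle, i.e. has as many edges as nodes. (A solution $y \in \mathbb{F}_2^S$ of $Ay=d$ corresponds to orienting each edge $j$ towards node $q(j, y_j)$ so that every node has in-degree exactly $1$.) *)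

theory Defs
  imports "HOL-Probability.Probability" "HOL-Library.Z2" "HOL-Library.Uprod"
    "HOL-Library.Landau_Symbols"
begin

section \<open>Multigraphs and pseudoforests\<close>

text \<open>Edges have their own identity (multiple edges are allowed) and their ends form an
  unordered pair whose two entries may coincide (loops are allowed).\<close>

record ('v, 'e) multigraph =
  nodes :: "'v set"
  edges :: "'e set"
  ends :: "'e \<Rightarrow> 'v uprod"

definition adjacency :: "('v, 'e) multigraph \<Rightarrow> ('v \<times> 'v) set" where
  "adjacency G = {(u, v). \<exists>e\<in>edges G. ends G e = Upair u v}"

definition components :: "('v, 'e) multigraph \<Rightarrow> 'v set set" where
  "components G = {{w. (v, w) \<in> (adjacency G)\<^sup>*} | v. v \<in> nodes G}"

definition edges_within :: "('v, 'e) multigraph \<Rightarrow> 'v set \<Rightarrow> 'e set" where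
  "edges_within G K = {e \<in> edges G. set_uprod (ends G e) \<subseteq> K}"

text \<open>A cycle is identified with its set of edges: it is the edge set of a closed walk
  \<open>v\<^sub>0, e\<^sub>0, v\<^sub>1, e\<^sub>1, \<dots>, e\<^sub>k\<^sub>-\<^sub>1, v\<^sub>0\<close> of length \<open>k \<ge> 1\<close> with distinct nodes and distinct edges.
  A loop is a cycle of length 1, and two parallel edges form a cycle of length 2.\<close>

definition is_cycle :: "('v, 'e) multigraph \<Rightarrow> 'e set \<Rightarrow> bool" where
  "is_cycle G C \<longleftrightarrow> (\<exists>vs es. es \<noteq> [] \<and> length vs = length es \<and>
     distinct vs \<and> distinct es \<and> set vs \<subseteq> nodes G \<and> set es \<subseteq> edges G \<and> C = set es \<and>
     (\<forall>i<length es. ends G (es ! i) = Upair (vs ! i) (vs ! (Suc i mod length es))))"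

definition pseudoforest :: "('v, 'e) multigraph \<Rightarrow> bool" where
  "pseudoforest G \<longleftrightarrow> (\<forall>K\<in>components G. \<exists>!C. is_cycle G C \<and> C \<subseteq> edges_within G K)"

section \<open>Matrices over \<open>\<bbbF>\<^sub>2\<close> with arbitrary index sets\<close>

text \<open>A matrix with rows \<open>I\<close> and columns \<open>J\<close> is a function on \<open>I \<times> J\<close>; the type \<^typ>\<open>bit\<close>
  is the field with two elements.\<close>

definition mat_mult :: "'j set \<Rightarrow> ('i \<times> 'j \<Rightarrow> bit) \<Rightarrow> ('j \<times> 'k \<Rightarrow> bit) \<Rightarrow> 'i \<times> 'k \<Rightarrow> bit" where
  "mat_mult J M N = (\<lambda>(i, k). \<Sum>j\<in>J. M (i, j) * N (j, k))"

definition mat_vec :: "'j set \<Rightarrow> ('i \<times> 'j \<Rightarrow> bit) \<Rightarrow> ('j \<Rightarrow> bit) \<Rightarrow> 'i \<Rightarrow> bit" where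
  "mat_vec J M x = (\<lambda>i. \<Sum>j\<in>J. M (i, j) * x j)"

section \<open>The random linear system\<close>

text \<open>The label set \<open>{0, 1}\<close> of the two ends of an edge is rendered as the type \<^typ>\<open>bit\<close>.\<close>

definition G_of :: "nat \<Rightarrow> 'a set \<Rightarrow> ('a \<times> bit \<Rightarrow> nat) \<Rightarrow> (nat, 'a) multigraph" where
  "G_of n S q = \<lparr>nodes = {1..n}, edges = S, ends = (\<lambda>j. Upair (q (j, 0)) (q (j, 1)))\<rparr>"

definition A_of :: "('a \<times> bit \<Rightarrow> nat) \<Rightarrow> nat \<times> 'a \<Rightarrow> bit" where
  "A_of q = (\<lambda>(i, j). if (q (j, 0) = i) \<noteq> (q (j, 1) = i) then 1 else 0)"

definition d_of :: "'a set \<Rightarrow> ('a \<times> bit \<Rightarrow> nat) \<Rightarrow> nat \<Rightarrow> bit" where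
  "d_of S q = (\<lambda>i. of_nat (card {j \<in> S. q (j, 0) = i} + 1))"

definition b_of :: "nat \<Rightarrow> nat" where
  "b_of n = nat \<lceil>real n - 1 / 9 * ln (real n)\<rceil>"

definition solvable :: "nat \<Rightarrow> 'a set \<Rightarrow> ('a \<times> bit \<Rightarrow> nat) \<Rightarrow> ('a \<times> nat \<Rightarrow> bit) \<Rightarrow> bool" where
  "solvable n S q H \<longleftrightarrow> (\<exists>x \<in> {1..b_of n} \<rightarrow>\<^sub>E UNIV.
     \<forall>i\<in>{1..n}. mat_vec {1..b_of n} (mat_mult S (A_of q) H) x i = d_of S q i)"

text \<open>The joint law of the independent uniform pair \<open>(q, H)\<close>.\<close>

definition qH_pmf :: "nat \<Rightarrow> 'a set \<Rightarrow> (('a \<times> bit \<Rightarrow> nat) \<times> ('a \<times> nat \<Rightarrow> bit)) pmf" where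
  "qH_pmf n S = pair_pmf (pmf_of_set (S \<times> {0, 1} \<rightarrow>\<^sub>E {1..n}))
                         (pmf_of_set (S \<times> {1..b_of n} \<rightarrow>\<^sub>E UNIV))"

end

theory Submission
  imports Defs "HOL-Combinatorics.Permutations" "HOL-Real_Asymp.Real_Asymp"
begin

text \<open>
  A solution \<open>y\<close> of \<open>Ay = d\<close> makes every in-degree odd, hence equal to 1, so it is an orientation of
  \<open>G\<^sub>q\<close>; such a \<open>y\<close> exists iff \<open>G\<^sub>q\<close> is a pseudoforest. A pair \<open>(q, y)\<close> of this kind is a
  bijection from edges to heads together with an arbitrary map \<open>f\<close> from \<open>[n]\<close> to itself, and the
  solutions for \<open>q\<close> correspond to the sets \<open>W\<close> with \<open>f ` W = W\<close>, that is, to unions of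
  cycles of \<open>f\<close>. Let \<open>N\<close> be their number. A uniform pseudoforest thus yields a random map \<open>f\<close> with weight
  \<open>1/N\<close>. Splitting \<open>f\<close> into the permutation of its cyclic points and an acyclic rest shows that
  the average of \<open>N\<^sup>-\<^sup>s\<close> is the expectation of \<open>\<Prod>i<k. (i + 2\<^sup>-\<^sup>s) / (i + 1)\<close> over the number \<open>k\<close> of
  cyclic points, which is of order \<open>\<surd>n\<close>. This is at least of order \<open>n\<close> to the \<open>-1/4\<close> for
  \<open>s = 1\<close> and at most of order \<open>n\<close> to the \<open>-3/8\<close> for \<open>s = 2\<close>. As \<open>2^(n - b)\<close> is at most \<open>n\<close> to the \<open>1/9\<close>
  and \<open>1/9 < 3/8 - 1/4\<close>, a Markov argument gives \<open>N \<ge> 2^(n - b)\<close> for most pseudoforests. For these the expected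
  number of nonzero \<open>x\<close> with \<open>AHx = d\<close> is at least \<open>1/2\<close>, and the vectors \<open>Hx\<close> are pairwise
  independent, so the second moment method applies.
\<close>

section \<open>Self-maps of a finite set and their invariant sets\<close>

definition invs :: "'a set \<Rightarrow> ('a \<Rightarrow> 'a) \<Rightarrow> 'a set set" where
  "invs A f = {W. W \<subseteq> A \<and> f ` W = W}"

text \<open>For finite \<open>A\<close> these are the points on cycles of \<open>f\<close> inside
  \<open>A\<close>, the largest set that \<open>f\<close> permutes.\<close>

definition core :: "'a set \<Rightarrow> ('a \<Rightarrow> 'a) \<Rightarrow> 'a set" where
  "core A f = \<Union>(invs A f)"

text \<open>For finite \<open>A\<close> inside \<open>V\<close> these are the rooted forests on
  \<open>V\<close> with root set \<open>V - A\<close>, each other node pointing to its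
  parent.\<close>

definition acyclic_maps :: "'a set \<Rightarrow> 'a set \<Rightarrow> ('a \<Rightarrow> 'a) set" where
  "acyclic_maps A V = {r \<in> A \<rightarrow>\<^sub>E V. invs A r = {{}}}"

section \<open>Invariant sets and cycles of permutations\<close>

lemma finite_invs: "finite A \<Longrightarrow> finite (invs A f)"
  unfolding invs_def by (rule finite_subset[of _ "Pow A"]) auto

text \<open>The fixed point \<open>a\<close> is a cycle of its own, which an invariant set may
  contain or not independently of the rest.\<close>

lemma card_invs_insert_fixed:
  assumes "finite F" "a \<notin> F" "p permutes F"
  shows "card (invs (insert a F) p) = 2 * card (invs F p)"
proof -
  have pa: "p a = a"
    using assms permutes_not_in by metis
  have eq: "p ` insert a W = insert a W \<longleftrightarrow> p ` W = W" if "W \<subseteq> F" for W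
  proof -
    have "a \<notin> W" "a \<notin> p ` W"
      using that assms permutes_image[OF assms(3)] by auto
    then show ?thesis
      using pa by auto
  qed
  have "invs (insert a F) p = invs F p \<union> insert a ` invs F p" (is "?L = ?R")
  proof
    show "?L \<subseteq> ?R"
    proof
      fix W assume W: "W \<in> ?L"
      show "W \<in> ?R"
      proof (cases "a \<in> W")
        case False
        then show ?thesis using W by (auto simp: invs_def)
      next
        case True
        then have "W = insert a (W - {a})" "W - {a} \<subseteq> F"
          using W by (auto simp: invs_def)
        moreover from this have "p ` (W - {a}) = W - {a}"
          using W eq[of "W - {a}"] by (auto simp: invs_def)
        ultimately show ?thesis
          unfolding invs_def by blast
      qed
    qed
    show "?R \<subseteq> ?L"
      using eq by (auto simp: invs_def)
  qed
  moreover have "invs F p \<inter> insert a ` invs F p = {}"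
    using assms(2) by (auto simp: invs_def)
  moreover have "card (insert a ` invs F p) = card (invs F p)"
    by (rule card_image, rule inj_onI) (use assms(2) in \<open>auto simp: invs_def\<close>)
  ultimately show ?thesis
    using finite_invs[OF assms(1), of p] by (simp add: card_Un_disjoint)
qed

text \<open>Composing with the transposition inserts \<open>a\<close> into the cycle of
  \<open>p\<close> through \<open>b\<close>, right before \<open>b\<close>. The cycle number stays
  the same, and an invariant set of the new permutation contains \<open>a\<close> exactly when it
  contains \<open>b\<close>.\<close>

lemma card_invs_insert_transpose:
  assumes "finite F" "a \<notin> F" "p permutes F" "b \<in> F"
  shows "card (invs (insert a F) (Transposition.transpose a b \<circ> p)) = card (invs F p)"
proof -
  define r where "r = Transposition.transpose a b \<circ> p"
  have pa: "p a = a"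
    using assms permutes_not_in by metis
  have injp: "inj p"
    using assms(3) permutes_inj by blast
  then have injr: "inj r"
    by (simp add: r_def inj_compose)
  have ra: "r a = b"
    using pa by (simp add: r_def)
  have iff: "a \<in> W \<longleftrightarrow> b \<in> W" if "r ` W = W" for W
  proof
    assume "a \<in> W"
    then show "b \<in> W" using ra that by (metis imageI)
  next
    assume "b \<in> W"
    then have "r a \<in> r ` W" using ra that by simp
    then show "a \<in> W" using injr by (simp add: inj_image_mem_iff)
  qed
  have tr: "Transposition.transpose a b ` W = W" if "a \<in> W \<longleftrightarrow> b \<in> W" for W
    using that by (auto simp: Transposition.transpose_def image_iff)
  \<comment> \<open>The transposition maps a set that contains both or neither of \<open>a\<close>
    and \<open>b\<close> onto itself, so such a set is invariant under \<open>r\<close> exactly when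
    it is invariant under \<open>p\<close>.\<close>
  have rp: "r ` W = W \<longleftrightarrow> p ` W = W" if "a \<in> W \<longleftrightarrow> b \<in> W" for W
  proof -
    have "r ` W = W \<longleftrightarrow> Transposition.transpose a b ` (p ` W) = Transposition.transpose a b ` W"
      using tr[OF that] by (simp add: r_def image_comp)
    also have "\<dots> \<longleftrightarrow> p ` W = W"
      by (simp add: inj_image_eq_iff)
    finally show ?thesis .
  qed
  have eq: "p ` insert a W = insert a W \<longleftrightarrow> p ` W = W" if "W \<subseteq> F" for W
  proof -
    have "a \<notin> W" "a \<notin> p ` W"
      using that assms permutes_image[OF assms(3)] by auto
    then show ?thesis
      using pa by auto
  qed
  have "bij_betw (\<lambda>W. if b \<in> W then insert a W else W) (invs F p) (invs (insert a F) r)"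
  proof (rule bij_betw_byWitness[where f' = "\<lambda>W. W - {a}"])
    show "\<forall>W\<in>invs F p. (if b \<in> W then insert a W else W) - {a} = W"
      using assms(2) by (auto simp: invs_def)
    show "\<forall>W\<in>invs (insert a F) r. (if b \<in> W - {a} then insert a (W - {a}) else W - {a}) = W"
      using iff assms(2,4) by (auto simp: invs_def)
    show "(\<lambda>W. if b \<in> W then insert a W else W) ` invs F p \<subseteq> invs (insert a F) r"
    proof
      fix W' assume "W' \<in> (\<lambda>W. if b \<in> W then insert a W else W) ` invs F p"
      then obtain W where W: "W \<subseteq> F" "p ` W = W" "W' = (if b \<in> W then insert a W else W)"
        unfolding invs_def by blast
      have "a \<in> W' \<longleftrightarrow> b \<in> W'" "W' \<subseteq> insert a F"
        unfolding W(3) using W(1) assms(2,4) by auto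
      moreover have "p ` W' = W'"
        unfolding W(3) using W(2) eq[OF W(1)] by (cases "b \<in> W") (simp_all only: if_True if_False)
      ultimately show "W' \<in> invs (insert a F) r"
        unfolding invs_def mem_Collect_eq using rp[of W'] by iprover
    qed
    show "(\<lambda>W. W - {a}) ` invs (insert a F) r \<subseteq> invs F p"
    proof
      fix W' assume "W' \<in> (\<lambda>W. W - {a}) ` invs (insert a F) r"
      then obtain W where "W \<in> invs (insert a F) r" and W3: "W' = W - {a}"
        by blast
      then have W: "W \<subseteq> insert a F" "r ` W = W"
        unfolding invs_def by simp_all
      have pW: "p ` W = W"
        using rp[OF iff[OF W(2)]] W(2) by simp
      have "W' \<subseteq> F"
        using W(1) W3 by blast
      have "p ` W' = W'"
      proof (cases "a \<in> W")
        case True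
        then have "insert a W' = W"
          using W3 by blast
        then show ?thesis
          using eq[OF \<open>W' \<subseteq> F\<close>] pW by simp
      next
        case False
        then show ?thesis
          using W3 pW by simp
      qed
      with \<open>W' \<subseteq> F\<close> show "W' \<in> invs F p"
        by (simp add: invs_def)
    qed
  qed
  then show ?thesis
    unfolding r_def by (metis bij_betw_same_card)
qed

text \<open>The number of invariant sets is 2 to the number of cycles, so this is the generating
  function of the cycle number, a rising factorial. Each permutation of \<open>insert a F\<close>
  arises once from one of \<open>F\<close>: either \<open>a\<close> becomes a fixed point, at the
  cost of a factor \<open>1 / 2 ^ s\<close>, or it is inserted before one of the
  \<open>card F\<close> other points, at no cost.\<close>

lemma sum_permutes_card_invs:
  assumes "finite F"
  shows "(\<Sum>p | p permutes F. (1 / real (card (invs F p))) ^ s) = pochhammer (1 / 2 ^ s) (card F)"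
  using assms
proof (induction F)
  case empty
  have "invs {} (id :: 'a \<Rightarrow> 'a) = {{}}"
    by (auto simp: invs_def)
  moreover have "{p. p permutes ({} :: 'a set)} = {id}"
    by auto
  ultimately show ?case
    by (simp del: permutes_empty add: id_def)
next
  case (insert a F)
  let ?S = "\<Sum>p | p permutes F. (1 / real (card (invs F p))) ^ s"
  have "(\<Sum>p | p permutes insert a F. (1 / real (card (invs (insert a F) p))) ^ s)
      = (\<Sum>b\<in>insert a F. \<Sum>p | p permutes F.
          (1 / real (card (invs (insert a F) (Transposition.transpose a b \<circ> p)))) ^ s)"
    by (rule sum_over_permutations_insert[OF insert.hyps])
  also have "\<dots> = (\<Sum>p | p permutes F. (1 / real (card (invs (insert a F) p))) ^ s)
      + (\<Sum>b\<in>F. \<Sum>p | p permutes F.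
          (1 / real (card (invs (insert a F) (Transposition.transpose a b \<circ> p)))) ^ s)"
    using insert by simp
  also have "(\<Sum>p | p permutes F. (1 / real (card (invs (insert a F) p))) ^ s) = 1 / 2 ^ s * ?S"
    unfolding sum_distrib_left using insert
    by (intro sum.cong refl) (simp add: card_invs_insert_fixed power_divide power_mult_distrib)
  also have "(\<Sum>b\<in>F. \<Sum>p | p permutes F.
          (1 / real (card (invs (insert a F) (Transposition.transpose a b \<circ> p)))) ^ s) = (\<Sum>b\<in>F. ?S)"
    by (intro sum.cong refl) (use insert in \<open>simp add: card_invs_insert_transpose\<close>)
  also have "1 / 2 ^ s * ?S + (\<Sum>b\<in>F. ?S) = (1 / 2 ^ s + real (card F)) * ?S"
    by (simp add: algebra_simps)
  finally show ?case
    unfolding insert.IH card_insert_disjoint[OF insert.hyps] pochhammer_Suc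
    by (simp only: mult.commute)
qed

section \<open>Splitting a self-map into its cyclic part and a forest\<close>

lemma core_in_invs: "core A f \<in> invs A f"
proof -
  have "f ` \<Union>(invs A f) = \<Union>((`) f ` invs A f)"
    by blast
  also have "(`) f ` invs A f = id ` invs A f"
    by (rule image_cong) (simp_all add: invs_def)
  finally have "f ` \<Union>(invs A f) = \<Union>(invs A f)"
    by simp
  moreover have "\<Union>(invs A f) \<subseteq> A"
    unfolding invs_def by blast
  ultimately show ?thesis
    by (simp only: core_def invs_def[of A f] mem_Collect_eq simp_thms)
qed

lemma invs_subset_core: "W \<in> invs A f \<Longrightarrow> W \<subseteq> core A f"
  unfolding core_def by auto

text \<open>A map is determined by its core \<open>K\<close>, the permutation induced on
  \<open>K\<close> and the restriction to the rest, which is acyclic. All invariant sets lie in the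
  core, so their number depends on the permutation alone.\<close>

lemma sum_maps_core:
  assumes "finite V" "A \<subseteq> V"
  shows "(\<Sum>f\<in>A \<rightarrow>\<^sub>E V. \<phi> (card (invs A f))) =
    (\<Sum>K\<in>Pow A. real (card (acyclic_maps (A - K) V)) * (\<Sum>p | p permutes K. \<phi> (card (invs K p))))"
proof -
  have finA: "finite A"
    using assms finite_subset by blast
  have inj: "inj_on f W" if "f ` W = W" "W \<subseteq> A" for f W
    using that finA by (metis eq_card_imp_inj_on finite_subset)
  define T where "T = (SIGMA K : Pow A. {p. p permutes K} \<times> acyclic_maps (A - K) V)"
  define glue :: "'a set \<times> ('a \<Rightarrow> 'a) \<times> ('a \<Rightarrow> 'a) \<Rightarrow> 'a \<Rightarrow> 'a"
    where "glue = (\<lambda>(K, p, r) x. if x \<in> K then p x else r x)"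
  \<comment> \<open>The permutation is continued by the identity, as \<open>permutes\<close>
    demands; the rest is cut down to \<open>A - core A f\<close> to be extensional.\<close>
  define split where "split = (\<lambda>f. (core A f, (\<lambda>x. if x \<in> core A f then f x else x),
      restrict f (A - core A f)))"
  have glue_core: "core A (glue (K, p, r)) = K" and glue_mem: "glue (K, p, r) \<in> A \<rightarrow>\<^sub>E V"
    if "K \<subseteq> A" "p permutes K" "r \<in> acyclic_maps (A - K) V" for K p r
  proof -
    let ?f = "glue (K, p, r)"
    have fK: "?f ` K = K"
      using permutes_image[OF that(2)] by (auto simp: glue_def image_iff)
    then have "K \<in> invs A ?f"
      using that by (simp add: invs_def)
    moreover have "W \<subseteq> K" if W: "W \<in> invs A ?f" for W
    proof -
      \<comment> \<open>Adding \<open>K\<close> to an invariant set keeps it invariant. The finite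
        set \<open>?U\<close> is mapped onto itself, hence injectively, so \<open>?U - K\<close> is
        invariant as well; there the map is \<open>r\<close>, whose acyclicity leaves only the empty
        set.\<close>
      let ?U = "W \<union> K"
      have U: "?f ` ?U = ?U" "?U \<subseteq> A"
        using W fK \<open>K \<subseteq> A\<close> by (auto simp: invs_def image_Un)
      have "?f ` (?U - K) = ?U - K"
        using inj_on_image_set_diff[OF inj[OF U], of ?U K] U fK by auto
      moreover have "?f ` (?U - K) = r ` (?U - K)"
        by (auto simp: glue_def image_iff)
      ultimately have "?U - K \<in> invs (A - K) r"
        using U by (auto simp: invs_def)
      then have "?U - K = {}"
        using \<open>r \<in> acyclic_maps (A - K) V\<close> by (auto simp: acyclic_maps_def)
      then show ?thesis by auto
    qed
    ultimately show "core A ?f = K"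
      unfolding core_def by blast
    show "?f \<in> A \<rightarrow>\<^sub>E V"
      using that assms(2) permutes_in_image[OF that(2)]
      by (fastforce simp: glue_def acyclic_maps_def PiE_iff extensional_def)
  qed
  have "(\<Sum>f\<in>A \<rightarrow>\<^sub>E V. \<phi> (card (invs A f))) = (\<Sum>(K, p, r)\<in>T. \<phi> (card (invs K p)))"
  proof (rule sum.reindex_bij_witness[where i = glue and j = split])
    fix f assume f: "f \<in> A \<rightarrow>\<^sub>E V"
    let ?K = "core A f" and ?p = "\<lambda>x. if x \<in> core A f then f x else x"
    have K: "?K \<subseteq> A" "f ` ?K = ?K"
      using core_in_invs[of A f] by (auto simp: invs_def)
    show "glue (split f) = f"
      using f K by (auto simp: glue_def split_def fun_eq_iff PiE_iff extensional_def)
    have "?p permutes ?K"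
    proof (rule bij_imp_permutes)
      have "inj_on ?p ?K" "?p ` ?K = ?K"
        using inj[OF K(2,1)] K(2) by (auto simp: inj_on_def image_iff)
      then show "bij_betw ?p ?K ?K"
        by (simp add: bij_betw_def)
    qed auto
    moreover have "restrict f (A - ?K) \<in> acyclic_maps (A - ?K) V"
    proof -
      have "W = {}" if "W \<in> invs (A - ?K) (restrict f (A - ?K))" for W
      proof -
        have "restrict f (A - ?K) ` W = f ` W"
          using that by (intro image_cong) (auto simp: invs_def)
        then have "W \<in> invs A f"
          using that by (auto simp: invs_def)
        then have "W \<subseteq> ?K"
          by (rule invs_subset_core)
        moreover have "W \<subseteq> A - ?K"
          using that by (simp add: invs_def)
        ultimately show ?thesis by blast
      qed
      moreover have "{} \<in> invs (A - ?K) (restrict f (A - ?K))"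
        by (simp add: invs_def)
      moreover have "restrict f (A - ?K) \<in> (A - ?K) \<rightarrow>\<^sub>E V"
        using f by auto
      ultimately show ?thesis
        unfolding acyclic_maps_def by blast
    qed
    ultimately show "split f \<in> T"
      using K by (simp add: T_def split_def)
    have "invs ?K ?p = invs A f"
    proof (rule set_eqI)
      fix W
      have "?p ` W = f ` W" if "W \<subseteq> ?K"
        using that by (intro image_cong) auto
      then have "W \<subseteq> ?K \<and> ?p ` W = W \<longleftrightarrow> W \<subseteq> ?K \<and> f ` W = W"
        by (intro conj_cong refl) (simp only:)
      then have "W \<in> invs ?K ?p \<longleftrightarrow> W \<subseteq> ?K \<and> f ` W = W"
        by (simp only: invs_def mem_Collect_eq)
      also have "\<dots> \<longleftrightarrow> W \<in> invs A f"
      proof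
        assume "W \<subseteq> ?K \<and> f ` W = W"
        then show "W \<in> invs A f"
          using K(1) unfolding invs_def by auto
      next
        assume W: "W \<in> invs A f"
        then have "f ` W = W"
          by (simp only: invs_def mem_Collect_eq)
        with invs_subset_core[OF W] show "W \<subseteq> ?K \<and> f ` W = W" ..
      qed
      finally show "W \<in> invs ?K ?p \<longleftrightarrow> W \<in> invs A f" .
    qed
    then show "(case split f of (K, p, r) \<Rightarrow> \<phi> (card (invs K p))) = \<phi> (card (invs A f))"
      by (simp add: split_def)
  next
    fix t assume "t \<in> T"
    then obtain K p r where t: "t = (K, p, r)" "K \<subseteq> A" "p permutes K"
      "r \<in> acyclic_maps (A - K) V"
      by (auto simp: T_def)
    show "glue t \<in> A \<rightarrow>\<^sub>E V"
      using glue_mem t by simp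
    show "split (glue t) = t"
      using t glue_core[OF t(2-4)] permutes_not_in[OF t(3)]
      by (auto simp: split_def glue_def fun_eq_iff acyclic_maps_def PiE_iff extensional_def
          restrict_def)
  qed
  also have "\<dots> = (\<Sum>K\<in>Pow A. \<Sum>(p, r)\<in>{p. p permutes K} \<times> acyclic_maps (A - K) V.
      \<phi> (card (invs K p)))"
  proof -
    have "finite {p. p permutes K}" if "K \<subseteq> A" for K
      using that finA finite_permutations finite_subset by blast
    moreover have "finite (acyclic_maps (A - K) V)" for K
      by (rule finite_subset[of _ "A - K \<rightarrow>\<^sub>E V"])
        (use finA assms in \<open>auto simp: acyclic_maps_def intro!: finite_PiE\<close>)
    ultimately show ?thesis
      unfolding T_def using finA by (subst sum.Sigma) (auto simp: case_prod_unfold)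
  qed
  also have "\<dots> = (\<Sum>K\<in>Pow A. real (card (acyclic_maps (A - K) V)) *
      (\<Sum>p | p permutes K. \<phi> (card (invs K p))))"
    by (simp add: sum.cartesian_product[symmetric] sum_distrib_left)
  finally show ?thesis .
qed

section \<open>Counting forests\<close>

lemma sum_Pow_card:
  assumes "finite A"
  shows "(\<Sum>K\<in>Pow A. F (card K)) = (\<Sum>k\<le>card A. real (card A choose k) * F k)"
proof -
  have "(\<Sum>K\<in>Pow A. F (card K)) = (\<Sum>k\<le>card A. \<Sum>K\<in>{K \<in> Pow A. card K = k}. F (card K))"
    by (rule sum.group[symmetric]) (use assms in \<open>auto simp: card_mono\<close>)
  also have "\<dots> = (\<Sum>k\<le>card A. real (card A choose k) * F k)"
    using n_subsets[OF assms] by (intro sum.cong refl) simp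
  finally show ?thesis .
qed

text \<open>This decomposes all \<open>v ^ a\<close> maps by core size, with the forest count
  already inserted. Multiplied by \<open>v\<close>, each summand is a difference of consecutive
  values of \<open>?g\<close>, and \<open>?g (Suc a)\<close> vanishes through its binomial
  coefficient.\<close>

lemma sum_falling_telescope:
  assumes "v > 0"
  shows "(\<Sum>k\<le>a. real (a choose k) * fact k * (real v - real (a - k)) * real v ^ (a - k) / real v)
    = real v ^ a"
proof -
  let ?g = "\<lambda>k. real (a choose k) * fact k * real v ^ (Suc a - k)"
  have step: "real (a choose k) * fact k * (real v - real (a - k)) * real v ^ (a - k)
      = ?g k - ?g (Suc k)" if "k \<le> a" for k
  proof -
    have "real (a choose Suc k) * fact (Suc k) = real (a choose k) * fact k * real (a - k)"
    proof -
      have "Suc k * (a choose Suc k) = (a choose k) * (a - k)"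
        using binomial_absorb_comp[of a k] binomial_absorption[of k a]
        by (metis mult.commute)
      then have "real (Suc k) * real (a choose Suc k) = real (a choose k) * real (a - k)"
        by (metis of_nat_mult)
      then show ?thesis
        by (simp add: algebra_simps del: of_nat_Suc)
    qed
    then have "?g (Suc k) = real (a choose k) * fact k * real (a - k) * real v ^ (a - k)"
      by simp
    moreover have "?g k = real (a choose k) * fact k * real v * real v ^ (a - k)"
      using that by (simp add: Suc_diff_le)
    ultimately show ?thesis
      by (simp only: left_diff_distrib right_diff_distrib)
  qed
  have "(\<Sum>k\<le>a. real (a choose k) * fact k * (real v - real (a - k)) * real v ^ (a - k))
      = (\<Sum>k\<le>a. ?g k - ?g (Suc k))"
    using step by (intro sum.cong) auto
  also have "\<dots> = ?g 0 - ?g (Suc a)"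
    by (rule sum_telescope)
  also have "\<dots> = real v ^ Suc a"
    by simp
  finally show ?thesis
    using assms by (simp flip: sum_divide_distrib)
qed

text \<open>Cayley's formula for forests with prescribed roots, written with a division so that
  empty \<open>A\<close> needs no special exponent. When all maps are split by their cores, every
  nonempty core leaves a smaller domain for the induction hypothesis, and the telescoping identity
  determines the remaining term.\<close>

lemma card_acyclic_maps:
  assumes "finite V" "V \<noteq> {}" "A \<subseteq> V"
  shows "real (card (acyclic_maps A V)) =
    (real (card V) - real (card A)) * real (card V) ^ card A / real (card V)"
  using assms(3)
proof (induction "card A" arbitrary: A rule: less_induct)
  case less
  have finA: "finite A"
    using less assms finite_subset by blast
  let ?v = "card V" and ?a = "card A"
  let ?F = "\<lambda>k. fact k * (real ?v - real (?a - k)) * real ?v ^ (?a - k) / real ?v"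
  have vpos: "?v > 0"
    using assms by (simp add: card_gt_0_iff)
  have "real ?v ^ ?a = (\<Sum>f\<in>A \<rightarrow>\<^sub>E V. 1)"
    using finA by (simp add: card_PiE)
  also have "\<dots> = (\<Sum>K\<in>Pow A. real (card (acyclic_maps (A - K) V)) * fact (card K))"
    using sum_maps_core[OF assms(1) less.prems, of "\<lambda>_. 1"] finA
    by (simp add: card_permutations finite_subset)
  also have "\<dots> = real (card (acyclic_maps A V)) +
      (\<Sum>K\<in>Pow A - {{}}. real (card (acyclic_maps (A - K) V)) * fact (card K))"
    using finA by (subst sum.remove[of _ "{}"]) auto
  also have "(\<Sum>K\<in>Pow A - {{}}. real (card (acyclic_maps (A - K) V)) * fact (card K))
     = (\<Sum>K\<in>Pow A - {{}}. ?F (card K))"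
  proof (rule sum.cong[OF refl])
    fix K assume K: "K \<in> Pow A - {{}}"
    then have "K \<subseteq> A" "K \<noteq> {}" by auto
    then have "card (A - K) < ?a"
      using finA by (intro psubset_card_mono) auto
    moreover have "card (A - K) = ?a - card K"
      using \<open>K \<subseteq> A\<close> finA by (simp add: card_Diff_subset finite_subset)
    ultimately show "real (card (acyclic_maps (A - K) V)) * fact (card K) = ?F (card K)"
      using less.hyps[of "A - K"] less.prems by (subst less.hyps) auto
  qed
  also have "(\<Sum>K\<in>Pow A - {{}}. ?F (card K)) = (\<Sum>K\<in>Pow A. ?F (card K)) - ?F 0"
    using finA by (subst sum.remove[of "Pow A" "{}"]) auto
  also have "(\<Sum>K\<in>Pow A. ?F (card K)) = (\<Sum>k\<le>?a. real (?a choose k) * ?F k)"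
    by (rule sum_Pow_card[OF finA])
  also have "\<dots> = real ?v ^ ?a"
    using sum_falling_telescope[OF vpos, of ?a] by (simp add: mult.assoc)
  finally show ?case
    by simp
qed

text \<open>A core of size \<open>k\<close> leaves a forest with \<open>k\<close> roots on
  \<open>n\<close> nodes, and the permutations of the core contribute the rising factorial.\<close>

lemma sum_maps_card_invs:
  assumes "finite V" "V \<noteq> {}" and n: "n = card V"
  shows "(\<Sum>f\<in>V \<rightarrow>\<^sub>E V. (1 / real (card (invs V f))) ^ s) =
    (\<Sum>k\<le>n. real (n choose k) * (real k * real n ^ (n - k) / real n) * pochhammer (1 / 2 ^ s) k)"
proof -
  let ?F = "\<lambda>k. real k * real n ^ (n - k) / real n * pochhammer (1 / 2 ^ s) k"
  have "(\<Sum>f\<in>V \<rightarrow>\<^sub>E V. (1 / real (card (invs V f))) ^ s) =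
    (\<Sum>K\<in>Pow V. real (card (acyclic_maps (V - K) V)) * (\<Sum>p | p permutes K. (1 / real (card (invs K p))) ^ s))"
    by (rule sum_maps_core) (use assms in auto)
  also have "\<dots> = (\<Sum>K\<in>Pow V. ?F (card K))"
  proof (rule sum.cong[OF refl])
    fix K assume "K \<in> Pow V"
    then have K: "K \<subseteq> V" "finite K" "card K \<le> n"
      using assms finite_subset[of K V] card_mono[of V K] by auto
    then have "card (V - K) = n - card K"
      using assms by (simp add: card_Diff_subset)
    then have "real (card (acyclic_maps (V - K) V)) = real (card K) * real n ^ (n - card K) / real n"
      using card_acyclic_maps[OF assms(1,2), of "V - K"] K n by simp
    then show "real (card (acyclic_maps (V - K) V)) *
        (\<Sum>p | p permutes K. (1 / real (card (invs K p))) ^ s) = ?F (card K)"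
      using sum_permutes_card_invs[OF K(2)] by simp
  qed
  also have "\<dots> = (\<Sum>k\<le>n. real (n choose k) * ?F k)"
    unfolding n by (rule sum_Pow_card[OF assms(1)])
  finally show ?thesis
    by (simp only: mult.assoc)
qed

section \<open>Asymptotics of the moments\<close>

text \<open>The probability that a uniform self-map of \<open>[n]\<close> has at least \<open>k\<close> cyclic points.\<close>

definition no_collision :: "nat \<Rightarrow> nat \<Rightarrow> real" where
  "no_collision n k = (\<Prod>i<k. 1 - real i / real n)"

section \<open>Number of cyclic points, and bounds on rising factorials\<close>

lemma no_collision_Suc: "no_collision n (Suc k) = no_collision n k * (1 - real k / real n)"
  by (simp add: no_collision_def)

text \<open>For positive \<open>n\<close> this is the probability of exactly \<open>k\<close> cyclic
  points; as a difference of tails it can be summed by telescoping.\<close>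

lemma no_collision_telescope:
  "no_collision n k * (real k / real n) = no_collision n k - no_collision n (Suc k)"
  by (simp add: no_collision_Suc algebra_simps)

text \<open>The range includes \<open>Suc n\<close>, where telescoped sums end: the extra factor at
  \<open>i = n\<close> is still nonnegative.\<close>

lemma no_collision_nonneg:
  assumes "k \<le> Suc n"
  shows "0 \<le> no_collision n k"
  unfolding no_collision_def by (rule prod_nonneg) (use assms in \<open>auto simp: divide_simps\<close>)

lemma no_collision_le_1:
  assumes "k \<le> Suc n"
  shows "no_collision n k \<le> 1"
  unfolding no_collision_def by (rule prod_le_1) (use assms in \<open>auto simp: divide_simps\<close>)

lemma no_collision_le_exp:
  assumes "k \<le> Suc n"
  shows "no_collision n k \<le> exp (- (real k * (real k - 1) / (2 * real n)))"
proof -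
  have "no_collision n k \<le> (\<Prod>i<k. exp (- (real i / real n)))"
    unfolding no_collision_def
  proof (rule prod_mono)
    fix i assume "i \<in> {..<k}"
    then have "real i / real n \<le> 1"
      using assms by (auto simp: divide_simps)
    then show "0 \<le> 1 - real i / real n \<and> 1 - real i / real n \<le> exp (- (real i / real n))"
      using exp_ge_add_one_self[of "- (real i / real n)"] by simp
  qed
  also have "\<dots> = exp (- (\<Sum>i<k. real i) / real n)"
    by (simp add: exp_sum[symmetric] sum_negf sum_divide_distrib)
  also have "(\<Sum>i<k. real i) = real k * (real k - 1) / 2"
    by (induction k) (auto simp: field_simps)
  finally show ?thesis
    by simp
qed

text \<open>Passing from \<open>k\<close> to \<open>Suc k\<close> multiplies both sides by
  \<open>(n - k) / n\<close>.\<close>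

lemma binomial_fact_no_collision:
  assumes "n > 0" "k \<le> n"
  shows "real (n choose k) * fact k * real n ^ (n - k) = real n ^ n * no_collision n k"
  using assms(2)
proof (induction k)
  case 0
  then show ?case by (simp add: no_collision_def)
next
  case (Suc k)
  have "real (Suc k) * real (n choose Suc k) = real (n choose k) * real (n - k)"
    by (metis of_nat_mult binomial_absorb_comp binomial_absorption mult.commute)
  then have "real (n choose Suc k) * fact (Suc k) = real (n choose k) * fact k * real (n - k)"
    by (simp add: algebra_simps del: of_nat_Suc)
  then have "real n * (real (n choose Suc k) * fact (Suc k) * real n ^ (n - Suc k))
      = real (n choose k) * fact k * real n ^ Suc (n - Suc k) * real (n - k)"
    by simp
  also have "Suc (n - Suc k) = n - k"
    using Suc.prems by simp
  also have "real (n choose k) * fact k * real n ^ (n - k) * real (n - k)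
      = real n * (real n ^ n * no_collision n (Suc k))"
    using Suc assms(1) by (simp add: no_collision_Suc field_simps)
  finally show ?case
    using assms(1) by simp
qed

text \<open>Taking out \<open>n ^ n\<close> turns the count into an expectation over the number
  \<open>k\<close> of cyclic points; dividing by \<open>fact k\<close> turns the rising factorial
  into an average over permutations.\<close>

lemma weighted_sum_no_collision:
  assumes "n > 0"
  shows "(\<Sum>k\<le>n. real (n choose k) * (real k * real n ^ (n - k) / real n) * pochhammer u k)
    = real n ^ n * (\<Sum>k\<le>n. (no_collision n k - no_collision n (Suc k)) * (pochhammer u k / fact k))"
  unfolding sum_distrib_left no_collision_telescope[symmetric]
proof (rule sum.cong[OF refl])
  fix k assume "k \<in> {..n}"
  then have "real (n choose k) * fact k * real n ^ (n - k) = real n ^ n * no_collision n k"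
    using binomial_fact_no_collision[OF assms] by simp
  then have "real (n choose k) * real n ^ (n - k) = real n ^ n * no_collision n k / fact k"
    by (simp add: field_simps)
  then have "real (n choose k) * real n ^ (n - k) * (real k / real n * pochhammer u k)
    = real n ^ n * no_collision n k / fact k * (real k / real n * pochhammer u k)"
    by (simp only:)
  then show "real (n choose k) * (real k * real n ^ (n - k) / real n) * pochhammer u k
    = real n ^ n * (no_collision n k * (real k / real n) * (pochhammer u k / fact k))"
    by (simp add: mult_ac)
qed

text \<open>Consecutive values have quotient (k + 1/2) / (k + 1). The geometric mean of
  \<open>k\<close> and \<open>k + 1\<close> is at most their arithmetic mean, so the quotient is at
  least sqrt k / sqrt (k + 1).\<close>

lemma pochhammer_half_ge:
  assumes "k > 0"
  shows "1 / (2 * sqrt (real k)) \<le> pochhammer (1/2) k / fact k"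
  using assms
proof (induction k rule: nat_induct_non_zero)
  case 1
  then show ?case by simp
next
  case (Suc k)
  have "(real k) * (real k + 1) \<le> (real k + 1/2)\<^sup>2"
    by (simp add: power2_eq_square algebra_simps)
  then have "sqrt (real k) * sqrt (real k + 1) \<le> real k + 1/2"
    by (simp add: real_le_lsqrt flip: real_sqrt_mult)
  then have "sqrt (real k) * sqrt (real k + 1) / (real k + 1) \<le> (real k + 1/2) / (real k + 1)"
    by (intro divide_right_mono) auto
  moreover have "sqrt (real k) * sqrt (real k + 1) / (real k + 1) = sqrt (real k) / sqrt (real k + 1)"
    using real_sqrt_mult_self[of "real k + 1"] by (simp add: divide_simps)
  ultimately have *: "sqrt (real k) / sqrt (real k + 1) \<le> (real k + 1/2) / (real k + 1)"
    by (simp only:)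
  have "1 / (2 * sqrt (real (Suc k))) = 1 / (2 * sqrt (real k)) * (sqrt (real k) / sqrt (real k + 1))"
    using Suc by (simp add: field_simps)
  also have "\<dots> \<le> pochhammer (1/2) k / fact k * ((real k + 1/2) / (real k + 1))"
    by (rule mult_mono[OF Suc.IH *]) (auto intro!: divide_nonneg_nonneg pochhammer_nonneg)
  also have "\<dots> = pochhammer (1/2) (Suc k) / fact (Suc k)"
    by (simp add: pochhammer_Suc field_simps)
  finally show ?case .
qed

text \<open>Consecutive values have quotient 1 - (3/4) / (k + 1), which is at most exp (- (3/4) / (k
  + 1)), and 1 / (k + 1) is at least ln (k + 2) - ln (k + 1). The shift to \<open>k + 1\<close>
  makes the bound valid at 0.\<close>

lemma pochhammer_quarter_le:
  "pochhammer (1/4) k / fact k \<le> (real k + 1) powr (- 3/4)"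
proof (induction k)
  case 0
  then show ?case by simp
next
  case (Suc k)
  have "ln (1 + 1 / (real k + 1)) \<le> 1 / (real k + 1)"
    by (rule ln_add_one_self_le_self) simp
  moreover have "1 + 1 / (real k + 1) = (real k + 2) / (real k + 1)"
    by (simp add: field_simps)
  ultimately have ln: "ln (real k + 2) - ln (real k + 1) \<le> 1 / (real k + 1)"
    by (simp add: ln_div)
  have "(1/4 + real k) / (real k + 1) = 1 + (- 3/4 / (real k + 1))"
    by (simp add: field_simps)
  also have "\<dots> \<le> exp (- 3/4 / (real k + 1))"
    by (rule exp_ge_add_one_self)
  finally have *: "(1/4 + real k) / (real k + 1) \<le> exp (- 3/4 / (real k + 1))" .
  have "pochhammer (1/4) (Suc k) / fact (Suc k)
      = pochhammer (1/4) k / fact k * ((1/4 + real k) / (real k + 1))"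
    by (simp add: pochhammer_Suc field_simps)
  also have "\<dots> \<le> (real k + 1) powr (- 3/4) * exp (- 3/4 / (real k + 1))"
    by (rule mult_mono[OF Suc.IH *]) (auto intro!: divide_nonneg_nonneg pochhammer_nonneg)
  also have "\<dots> = exp (- 3/4 * ln (real k + 1) + - 3/4 / (real k + 1))"
    by (simp only: powr_def exp_add) simp
  also have "\<dots> \<le> exp (- 3/4 * ln (real k + 2))"
    using ln by (simp add: field_simps)
  also have "\<dots> = (real (Suc k) + 1) powr (- 3/4)"
    by (simp add: powr_def add.commute)
  finally show ?case .
qed

section \<open>Splitting the moment sums at the order of the square root of n\<close>

lemma ceiling_sqrt_bounds:
  assumes "n > 0"
  obtains m :: nat where "0 < m" "m \<le> n" "sqrt (real n) \<le> real m" "real m \<le> 2 * sqrt (real n)"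
proof
  let ?m = "nat \<lceil>sqrt (real n)\<rceil>"
  have 1: "1 \<le> sqrt (real n)"
    using assms by simp
  show "sqrt (real n) \<le> real ?m"
    by linarith
  with 1 show "0 < ?m"
    by linarith
  show "real ?m \<le> 2 * sqrt (real n)"
    using 1 by linarith
  have "sqrt (real n) * 1 \<le> sqrt (real n) * sqrt (real n)"
    using 1 by (intro mult_left_mono) auto
  then have "sqrt (real n) \<le> real n"
    by simp
  then show "?m \<le> n"
    by (simp add: nat_le_iff ceiling_le_iff)
qed

lemma sum_no_collision_telescope:
  assumes "j \<le> Suc m"
  shows "(\<Sum>k=j..m. no_collision n k - no_collision n (Suc k)) = no_collision n j - no_collision n (Suc m)"
  using sum_Suc_diff[OF assms, of "no_collision n"] by (simp add: sum_subtractf)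

text \<open>With probability at least 1/3 the number of cyclic points lies between 1 and
  \<open>m\<close>, which is of order sqrt n. There the weight is at least 1 / (2 sqrt m), hence at
  least \<open>real n powr (- 1/4) / 4\<close>.\<close>

lemma weighted_sum_half_ge:
  assumes "n > 0"
  shows "real n powr (- 1/4) / 12
    \<le> (\<Sum>k\<le>n. (no_collision n k - no_collision n (Suc k)) * (pochhammer (1/2) k / fact k))"
proof -
  obtain m where m: "0 < m" "m \<le> n" "sqrt (real n) \<le> real m" "real m \<le> 2 * sqrt (real n)"
    using ceiling_sqrt_bounds[OF assms] .
  have diff: "0 \<le> no_collision n k - no_collision n (Suc k)" if "k \<le> n" for k
    unfolding no_collision_telescope[symmetric] using that no_collision_nonneg[of k n] by simp
  \<comment> \<open>As \<open>m\<close> is at least sqrt n, the tail bound at \<open>Suc m\<close>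
    has an exponent of absolute value at least 1/2. Since exp (1/2) is at least 3/2, the tail is at
    most 2/3, while \<open>no_collision n 1\<close> is 1.\<close>
  have "sqrt (real n) * sqrt (real n) \<le> real m * real m"
    using m by (intro mult_mono) auto
  then have "1/2 \<le> (1 + real m) * real m / (2 * real n)"
    using assms by (simp add: field_simps)
  then have "no_collision n (Suc m) \<le> exp (- (1/2))"
    using no_collision_le_exp[of "Suc m" n] m by (intro order_trans[OF no_collision_le_exp]) auto
  also have "\<dots> = 1 / exp (1/2)"
    by (simp add: exp_minus field_simps)
  also have "\<dots> \<le> 1 / (1 + 1/2)"
    using exp_ge_add_one_self[of "1/2"] by (intro divide_left_mono) auto
  finally have tail: "1/3 \<le> no_collision n 1 - no_collision n (Suc m)"
    by (simp add: no_collision_def)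
  have powr: "sqrt (sqrt (real n)) = real n powr (1/4)"
    by (simp add: powr_half_sqrt[symmetric] powr_powr)
  have "sqrt (real m) \<le> sqrt (2 * sqrt (real n))"
    using m by simp
  also have "\<dots> \<le> 2 * sqrt (sqrt (real n))"
    using real_sqrt_le_mono[of 2 4] by (simp add: real_sqrt_mult mult_right_mono)
  finally have sm: "sqrt (real m) \<le> 2 * real n powr (1/4)"
    using powr by simp
  have "real n powr (- 1/4) / 12 = 1 / (2 * (2 * real n powr (1/4))) * (1/3)"
    using assms by (simp add: powr_minus field_simps)
  also have "\<dots> \<le> 1 / (2 * sqrt (real m)) * (no_collision n 1 - no_collision n (Suc m))"
    using tail sm m by (intro mult_mono divide_left_mono) auto
  also have "\<dots> = (\<Sum>k=1..m. (no_collision n k - no_collision n (Suc k)) * (1 / (2 * sqrt (real m))))"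
    using sum_no_collision_telescope[of 1 m n] by (simp flip: sum_distrib_right sum_divide_distrib)
  also have "\<dots> \<le> (\<Sum>k=1..m. (no_collision n k - no_collision n (Suc k)) * (pochhammer (1/2) k / fact k))"
  proof (intro sum_mono mult_left_mono)
    fix k assume k: "k \<in> {1..m}"
    then have "1 / (2 * sqrt (real m)) \<le> 1 / (2 * sqrt (real k))"
      by (intro divide_left_mono) auto
    also have "\<dots> \<le> pochhammer (1/2) k / fact k"
      using k by (intro pochhammer_half_ge) auto
    finally show "1 / (2 * sqrt (real m)) \<le> pochhammer (1/2) k / fact k" .
    show "0 \<le> no_collision n k - no_collision n (Suc k)"
      using diff k m by auto
  qed
  also have "\<dots> \<le> (\<Sum>k\<le>n. (no_collision n k - no_collision n (Suc k)) * (pochhammer (1/2) k / fact k))"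
    using m diff by (intro sum_mono2 mult_nonneg_nonneg divide_nonneg_nonneg pochhammer_nonneg) auto
  finally show ?thesis .
qed

text \<open>The weight is large when there are few cyclic points, so the sum is cut at
  \<open>m\<close>. Up to \<open>m\<close>, exactly \<open>k\<close> cyclic points have probability
  at most \<open>k / n\<close>, which gives a total of at most \<open>m powr (5/4) / n\<close>.
  Beyond \<open>m\<close> the weight is at most \<open>n powr (- 3/8)\<close> and the probabilities
  add up to at most 1. The two ranges contribute 4 and 1 to the constant.\<close>

lemma weighted_sum_quarter_le:
  assumes "n > 0"
  shows "(\<Sum>k\<le>n. (no_collision n k - no_collision n (Suc k)) * (pochhammer (1/4) k / fact k))
    \<le> 5 * real n powr (- 3/8)"
proof -
  obtain m where m: "0 < m" "m \<le> n" "sqrt (real n) \<le> real m" "real m \<le> 2 * sqrt (real n)"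
    using ceiling_sqrt_bounds[OF assms] .
  let ?f = "\<lambda>k. (no_collision n k - no_collision n (Suc k)) * (pochhammer (1/4) k / fact k)"
  have R0: "0 \<le> pochhammer (1/4) k / (fact k :: real)" for k
    by (intro divide_nonneg_nonneg pochhammer_nonneg) auto
  have R: "pochhammer (1/4) k / fact k \<le> real k powr (- 3/4)" if "k > 0" for k
    using that by (intro order_trans[OF pochhammer_quarter_le] powr_mono2') auto
  have powr: "sqrt (real n) = real n powr (1/2)"
    by (simp add: powr_half_sqrt)
  have "{..n} = {..m} \<union> {Suc m..n}"
    using m by auto
  then have "(\<Sum>k\<le>n. ?f k) = (\<Sum>k\<le>m. ?f k) + (\<Sum>k=Suc m..n. ?f k)"
    by (simp only:) (subst sum.union_disjoint, auto)
  \<comment> \<open>The summand at 0 is zero. It has to be removed because the bound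
    \<open>real k powr (- 3/4)\<close> on the weight fails at 0, where this power is 0.\<close>
  also have "(\<Sum>k\<le>m. ?f k) = (\<Sum>k=1..m. ?f k)"
    by (rule sum.mono_neutral_right) (auto simp: no_collision_def)
  also have "\<dots> \<le> (\<Sum>k=1..m. real m powr (1/4) / real n)"
  proof (rule sum_mono)
    fix k assume k: "k \<in> {1..m}"
    then have "?f k \<le> 1 * (real k / real n) * real k powr (- 3/4)"
      unfolding no_collision_telescope[symmetric] using m R R0[of k]
      by (intro mult_mono no_collision_le_1 no_collision_nonneg mult_nonneg_nonneg) auto
    also have "\<dots> = real k powr (1/4) / real n"
      using k powr_add[of "real k" 1 "-3/4"] by simp
    also have "\<dots> \<le> real m powr (1/4) / real n"
      using k by (intro divide_right_mono powr_mono2) auto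
    finally show "?f k \<le> real m powr (1/4) / real n" .
  qed
  also have "\<dots> = real m powr (5/4) / real n"
    using m powr_add[of "real m" 1 "1/4"] by simp
  also have "\<dots> \<le> (2 * sqrt (real n)) powr (5/4) / real n"
    using m by (intro divide_right_mono powr_mono2) auto
  also have "\<dots> = 2 powr (5/4) * real n powr (5/8) / real n powr 1"
    using assms by (simp add: powr powr_mult powr_powr)
  also have "\<dots> = 2 powr (5/4) * real n powr (- 3/8)"
    by (simp only: times_divide_eq_right[symmetric] powr_diff[symmetric]) simp
  also have "\<dots> \<le> 2 powr 2 * real n powr (- 3/8)"
    by (intro mult_right_mono powr_mono) auto
  also have "(2::real) powr 2 = 4"
    by (simp add: powr_numeral)
  also have "(\<Sum>k=Suc m..n. ?f k)
      \<le> (\<Sum>k=Suc m..n. (no_collision n k - no_collision n (Suc k)) * real n powr (- 3/8))"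
  proof (intro sum_mono mult_left_mono)
    fix k assume k: "k \<in> {Suc m..n}"
    have "pochhammer (1/4) k / fact k \<le> real k powr (- 3/4)"
      using R k by auto
    also have "\<dots> \<le> sqrt (real n) powr (- 3/4)"
      using k m assms by (intro powr_mono2') auto
    also have "\<dots> = real n powr (- 3/8)"
      by (simp add: powr powr_powr)
    finally show "pochhammer (1/4) k / fact k \<le> real n powr (- 3/8)" .
    show "0 \<le> no_collision n k - no_collision n (Suc k)"
      unfolding no_collision_telescope[symmetric] using k no_collision_nonneg[of k n] by simp
  qed
  also have "\<dots> = (no_collision n (Suc m) - no_collision n (Suc n)) * real n powr (- 3/8)"
    using sum_no_collision_telescope[of "Suc m" n n] m by (simp flip: sum_distrib_right)
  also have "\<dots> \<le> 1 * real n powr (- 3/8)"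
    using no_collision_le_1[of "Suc m" n] no_collision_nonneg[of "Suc n" n] m
    by (intro mult_right_mono) auto
  finally show ?thesis
    by simp
qed

section \<open>Pseudoforests and orientations\<close>

text \<open>Here \<open>g\<close> gives the head and \<open>h\<close> the tail of each edge. A cycle
  has as many nodes as edges, so its distinct heads are all of its nodes. Each node meets two
  consecutive cycle edges and is the head of only one, so it is the tail of the other; for a loop it
  is both ends.\<close>

lemma cycle_heads_invariant:
  fixes G :: "('v, 'e) multigraph"
  assumes g: "inj_on g (edges G)" and ends: "\<And>e. e \<in> edges G \<Longrightarrow> ends G e = Upair (g e) (h e)"
    and C: "is_cycle G C"
  shows "C \<noteq> {}" "C \<subseteq> edges G" "finite C" "h ` C = g ` C"
proof -
  obtain vs es where c: "es \<noteq> []" "length vs = length es" "distinct vs" "distinct es"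
    "set es \<subseteq> edges G" "C = set es"
    and inc: "\<And>i. i < length es \<Longrightarrow> ends G (es ! i) = Upair (vs ! i) (vs ! (Suc i mod length es))"
    using C unfolding is_cycle_def by blast
  let ?k = "length es"
  show "C \<noteq> {}" "C \<subseteq> edges G" "finite C"
    using c by auto
  have kpos: "0 < ?k"
    using c by simp
  have up: "Upair (g (es ! i)) (h (es ! i)) = Upair (vs ! i) (vs ! (Suc i mod ?k))" if "i < ?k" for i
    using inc[OF that] ends[of "es ! i"] c(5) that by force
  have mem: "g (es ! i) \<in> set vs" "h (es ! i) \<in> set vs" if "i < ?k" for i
  proof -
    have "vs ! i \<in> set vs" "vs ! (Suc i mod ?k) \<in> set vs"
      using that c(2) kpos by (auto intro!: nth_mem)
    then show "g (es ! i) \<in> set vs" "h (es ! i) \<in> set vs"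
      using up[OF that] by auto
  qed
  have injC: "inj_on g C"
    using g c inj_on_subset by blast
  have gsub: "g ` C \<subseteq> set vs" and hsub: "h ` C \<subseteq> set vs"
    using mem unfolding c(6) by (auto simp: in_set_conv_nth)
  have "card (g ` C) = card (set vs)"
    using card_image[OF injC] c by (simp add: distinct_card)
  then have gC: "g ` C = set vs"
    using gsub by (simp add: card_subset_eq)
  have "set vs \<subseteq> h ` C"
  proof
    fix v assume "v \<in> set vs"
    then obtain i where i: "i < ?k" "v = vs ! i"
      using c(2) by (auto simp: in_set_conv_nth)
    \<comment> \<open>The cyclic predecessor of position \<open>i\<close>, whose edge also meets
      \<open>vs ! i\<close>. It equals \<open>i\<close> only for a loop.\<close>
    define j where "j = (if i = 0 then ?k - 1 else i - 1)"
    have j: "j < ?k" "Suc j mod ?k = i"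
      using i kpos by (auto simp: j_def)
    have ui: "g (es ! i) = v \<or> h (es ! i) = v" and uj: "g (es ! j) = v \<or> h (es ! j) = v"
      using up[OF i(1)] up[OF j(1)] i j by auto
    have in_C: "es ! i \<in> C" "es ! j \<in> C"
      using i j c(6) by auto
    show "v \<in> h ` C"
    proof (cases "j = i")
      case True
      then have "h (es ! i) = v"
        using up[OF i(1)] i j by auto
      then show ?thesis
        using in_C by auto
    next
      case False
      then have "es ! i \<noteq> es ! j"
        using i j c(4) by (simp add: nth_eq_iff_index_eq)
      then have "g (es ! i) \<noteq> g (es ! j)"
        using injC in_C by (auto dest: inj_onD)
      then have "h (es ! i) = v \<or> h (es ! j) = v"
        using ui uj by auto
      then show ?thesis
        using in_C by auto
    qed
  qed
  with hsub gC show "h ` C = g ` C"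
    by blast
qed

text \<open>Every edge joins a node to its image under \<open>f\<close>. Walking along it either
  applies \<open>f\<close> or leads to a preimage, and in both cases some forward iterate still lies
  in \<open>W\<close>.\<close>

lemma invariant_set_eventually_reached:
  assumes g: "inj_on g (edges G)" and ends: "\<And>e. e \<in> edges G \<Longrightarrow> ends G e = Upair (g e) (h e)"
    and f: "\<And>e. e \<in> edges G \<Longrightarrow> f (g e) = h e"
    and W: "f ` W = W" and w: "w \<in> W" "(w, u) \<in> (adjacency G)\<^sup>*"
  shows "\<exists>m. (f ^^ m) u \<in> W"
  using w(2)
proof (induction rule: rtrancl_induct)
  case base
  then show ?case
    using w by (intro exI[of _ 0]) simp
next
  case (step a b)
  then obtain m where m: "(f ^^ m) a \<in> W"
    by blast
  from step obtain e where e: "e \<in> edges G" "ends G e = Upair a b"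
    by (auto simp: adjacency_def)
  then have "b = f a \<or> a = f b"
    using ends[OF e(1)] f[OF e(1)] by auto
  then show ?case
  proof
    assume "b = f a"
    then have "(f ^^ m) b = f ((f ^^ m) a)"
      by (simp add: funpow_swap1)
    then show ?case
      using m W by blast
  next
    assume "a = f b"
    then have "(f ^^ Suc m) b \<in> W"
      using m by (simp add: funpow_swap1)
    then show ?case
      by blast
  qed
qed

text \<open>By the pigeonhole principle two iterates coincide, so the earlier one is periodic. For
  its least period \<open>d\<close>, a coincidence of iterates \<open>x < y < d\<close> would give
  the smaller period \<open>d - y + x\<close>.\<close>

lemma finite_periodic_orbit:
  fixes f :: "'v \<Rightarrow> 'v"
  assumes "finite V" "\<And>i. (f ^^ i) v \<in> V"
  obtains i d where "0 < d" "(f ^^ d) ((f ^^ i) v) = (f ^^ i) v"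
    "distinct (map (\<lambda>k. (f ^^ k) ((f ^^ i) v)) [0..<d])"
proof -
  have "\<not> inj (\<lambda>i. (f ^^ i) v)"
  proof
    assume "inj (\<lambda>i. (f ^^ i) v)"
    then have "infinite (range (\<lambda>i. (f ^^ i) v))"
      by (simp add: finite_image_iff)
    moreover have "range (\<lambda>i. (f ^^ i) v) \<subseteq> V"
      using assms(2) by auto
    ultimately show False
      using assms(1) finite_subset by blast
  qed
  then obtain a b where ab: "a \<noteq> b" "(f ^^ a) v = (f ^^ b) v"
    by (auto simp: inj_def)
  define i where "i = min a b"
  define p where "p = (f ^^ i) v"
  have "(f ^^ (max a b - i)) p = (f ^^ max a b) v"
    unfolding p_def by (simp add: i_def flip: funpow_add[THEN fun_cong, unfolded o_apply])
  then have "0 < max a b - i \<and> (f ^^ (max a b - i)) p = p"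
    using ab by (auto simp: p_def i_def max_def min_def)
  then have ex: "\<exists>d. 0 < d \<and> (f ^^ d) p = p" by blast
  define d where "d = (LEAST d. 0 < d \<and> (f ^^ d) p = p)"
  have d: "0 < d" "(f ^^ d) p = p"
    using LeastI_ex[OF ex] by (auto simp: d_def)
  have least: "\<not> (0 < d' \<and> (f ^^ d') p = p)" if "d' < d" for d'
    using that not_less_Least unfolding d_def by blast
  have "(f ^^ x) p \<noteq> (f ^^ y) p" if "x < y" "y < d" for x y
  proof
    assume "(f ^^ x) p = (f ^^ y) p"
    then have "(f ^^ (d - y)) ((f ^^ x) p) = (f ^^ (d - y)) ((f ^^ y) p)"
      by simp
    then have "(f ^^ (d - y + x)) p = (f ^^ (d - y + y)) p"
      by (simp only: funpow_add o_apply)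
    then have "(f ^^ (d - y + x)) p = p"
      using that d by simp
    moreover have "0 < d - y + x" "d - y + x < d"
      using that by linarith+
    ultimately show False
      using least by blast
  qed
  then have "distinct (map (\<lambda>k. (f ^^ k) p) [0..<d])"
    by (auto simp: distinct_map inj_on_def) (metis linorder_neqE_nat)
  then show ?thesis
    using that[of d i] d by (simp add: p_def)
qed

text \<open>If every node is a head exactly once, the graph is that of the map \<open>f\<close> from
  a node to the tail of its incoming edge. The orbit of a node ends in a cycle inside its component.
  Two cycles of one component have the same heads because the iterates of each reach the
  other.\<close>

lemma oriented_imp_pseudoforest:
  fixes G :: "('v, 'e) multigraph"
  assumes fin: "finite (nodes G)" and g: "bij_betw g (edges G) (nodes G)"
    and h: "h \<in> edges G \<rightarrow> nodes G"
    and ends: "\<And>e. e \<in> edges G \<Longrightarrow> ends G e = Upair (g e) (h e)"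
  shows "pseudoforest G"
proof -
  define t where "t = inv_into (edges G) g"
  define f where "f = (\<lambda>v. h (t v))"
  have ginj: "inj_on g (edges G)"
    using g by (rule bij_betw_imp_inj_on)
  have t: "t v \<in> edges G" "g (t v) = v" if "v \<in> nodes G" for v
    using that g unfolding t_def
    by (auto simp: bij_betw_def inv_into_into f_inv_into_f)
  have tg: "t (g e) = e" if "e \<in> edges G" for e
    unfolding t_def using ginj that by simp
  have fg: "f (g e) = h e" if "e \<in> edges G" for e
    using tg[OF that] by (simp add: f_def)
  have gV: "g e \<in> nodes G" if "e \<in> edges G" for e
    using g that by (auto simp: bij_betw_def)
  have fV: "f v \<in> nodes G" if "v \<in> nodes G" for v
    using t that h by (auto simp: f_def)
  have adj: "(v, f v) \<in> adjacency G" if "v \<in> nodes G" for v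
    using t[OF that] ends[of "t v"] unfolding adjacency_def f_def by auto
  have "sym (adjacency G)"
    unfolding sym_def adjacency_def by (auto simp: Upair_inject) (metis Upair_inject)
  then have sym: "(b, a) \<in> (adjacency G)\<^sup>*" if "(a, b) \<in> (adjacency G)\<^sup>*" for a b
    using that by (meson sym_rtrancl symD)
  show ?thesis
    unfolding pseudoforest_def
  proof
    fix K assume "K \<in> components G"
    then obtain v where v: "v \<in> nodes G" and K: "K = {w. (v, w) \<in> (adjacency G)\<^sup>*}"
      by (auto simp: components_def)
    have orbit: "(f ^^ i) v \<in> nodes G" for i
      by (induction i) (use v fV in auto)
    have orbitK: "(f ^^ i) v \<in> K" for i
    proof (induction i)
      case (Suc i)
      then show ?case
        using adj[OF orbit[of i]] by (auto simp: K intro: rtrancl_into_rtrancl)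
    qed (simp add: K)
    obtain i d where d: "0 < d" "(f ^^ d) ((f ^^ i) v) = (f ^^ i) v"
      and dist: "distinct (map (\<lambda>k. (f ^^ k) ((f ^^ i) v)) [0..<d])"
      using finite_periodic_orbit[OF fin, of f v] orbit by blast
    define vs where "vs = map (\<lambda>k. (f ^^ k) ((f ^^ i) v)) [0..<d]"
    define es where "es = map t vs"
    have vsV: "(f ^^ k) ((f ^^ i) v) \<in> nodes G" "(f ^^ k) ((f ^^ i) v) \<in> K" for k
      using orbit[of "k + i"] orbitK[of "k + i"] by (simp_all add: funpow_add)
    have endst: "ends G (t w) = Upair w (f w)" if "w \<in> nodes G" for w
      using ends[OF t(1)[OF that]] t[OF that] by (simp add: f_def)
    have "is_cycle G (set es)"
      unfolding is_cycle_def
    proof (intro exI conjI allI impI)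
      show "es \<noteq> []" "length vs = length es" "distinct vs" "set vs \<subseteq> nodes G"
        using d dist vsV by (auto simp: es_def vs_def)
      have "inj_on t (set vs)"
        by (rule inj_on_inverseI[of _ g]) (use vsV t in \<open>auto simp: vs_def\<close>)
      then show "distinct es"
        using dist by (simp add: es_def distinct_map flip: vs_def)
      show "set es \<subseteq> edges G"
        using vsV t by (auto simp: es_def vs_def)
      fix k assume k: "k < length es"
      then have kd: "k < d"
        by (simp add: es_def vs_def)
      have "ends G (es ! k) = Upair (vs ! k) (f (vs ! k))"
        using kd vsV endst by (simp add: es_def vs_def)
      moreover have "f (vs ! k) = vs ! (Suc k mod length es)"
        using kd d by (cases "Suc k = d") (auto simp: es_def vs_def)
      ultimately show "ends G (es ! k) = Upair (vs ! k) (vs ! (Suc k mod length es))"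
        by simp
    qed (rule refl)
    moreover have "set es \<subseteq> edges_within G K"
    proof
      fix e assume "e \<in> set es"
      then obtain k where k: "e = t ((f ^^ k) ((f ^^ i) v))"
        by (auto simp: es_def vs_def)
      then show "e \<in> edges_within G K"
        using endst[OF vsV(1)[of k]] vsV(2)[of k] vsV(2)[of "Suc k"] t(1)[OF vsV(1)[of k]]
        by (simp add: edges_within_def)
    qed
    moreover have "g ` C1 \<subseteq> g ` C2"
      if C: "is_cycle G C1" "C1 \<subseteq> edges_within G K" "is_cycle G C2" "C2 \<subseteq> edges_within G K" for C1 C2
    proof -
      note c1 = cycle_heads_invariant[OF ginj ends C(1)]
      note c2 = cycle_heads_invariant[OF ginj ends C(3)]
      have inv: "f ` g ` C = g ` C" if "C \<subseteq> edges G" "h ` C = g ` C" for C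
      proof -
        have "f ` g ` C = h ` C"
          unfolding image_image using that(1) fg by (intro image_cong) auto
        then show ?thesis
          using that by simp
      qed
      have W1: "f ` g ` C1 = g ` C1" and W2: "f ` g ` C2 = g ` C2"
        using inv c1 c2 by auto
      have gK: "g e \<in> K" if "e \<in> edges_within G K" for e
        using that ends[of e] by (auto simp: edges_within_def)
      obtain w where w: "w \<in> g ` C2" "w \<in> K"
        using c2(1) gK C(4) by blast
      have "\<exists>m. (f ^^ m) u \<in> g ` C2" if "u \<in> g ` C1" for u
      proof -
        have "u \<in> K"
          using that gK C(2) by blast
        then have "(w, u) \<in> (adjacency G)\<^sup>*"
          using w(2) sym unfolding K by (blast intro: rtrancl_trans)
        then show ?thesis
          using invariant_set_eventually_reached[OF ginj ends fg W2 w(1)] by blast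
      qed
      then obtain m where m: "\<And>u. u \<in> g ` C1 \<Longrightarrow> (f ^^ m u) u \<in> g ` C2"
        by metis
      \<comment> \<open>This number of iterations suffices for all heads of \<open>C1\<close> at
        once, since an iterate stays among the heads of \<open>C2\<close> after its arrival. As
        \<open>f\<close> maps the heads of \<open>C1\<close> onto themselves, they all lie among
        those of \<open>C2\<close>.\<close>
      define M where "M = (\<Sum>u\<in>g ` C1. m u)"
      have stay: "(f ^^ k) u \<in> g ` C2" if "u \<in> g ` C2" for k u
        by (induction k) (use that W2 in auto)
      have reach: "(f ^^ M) u \<in> g ` C2" if u: "u \<in> g ` C1" for u
      proof -
        have "m u \<le> M"
          unfolding M_def using c1(3) u by (intro member_le_sum) auto
        then have "(f ^^ M) u = (f ^^ (M - m u)) ((f ^^ m u) u)"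
          by (simp flip: funpow_add[THEN fun_cong, unfolded o_apply])
        then show ?thesis
          using stay[OF m[OF u]] by simp
      qed
      have pow: "(f ^^ k) ` g ` C1 = g ` C1" for k
      proof (induction k)
        case (Suc k)
        have "(f ^^ Suc k) ` g ` C1 = f ` (f ^^ k) ` g ` C1"
          by (simp add: image_comp)
        then show ?case
          using Suc W1 by simp
      qed simp
      have "(f ^^ M) ` g ` C1 \<subseteq> g ` C2"
        using reach by (rule image_subsetI)
      then show ?thesis
        unfolding pow .
    qed
    moreover have "C1 = C2" if "is_cycle G C1" "is_cycle G C2" "g ` C1 = g ` C2" for C1 C2
      using that cycle_heads_invariant(2)[OF ginj ends] inj_on_image_eq_iff[OF ginj] by blast
    ultimately show "\<exists>!C. is_cycle G C \<and> C \<subseteq> edges_within G K"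
      by (intro ex1I[of _ "set es"] conjI) (metis subset_antisym)+
  qed
qed

section \<open>From pseudoforests to matchings of nodes with incident edges\<close>

lemma rtrancl_crossing:
  assumes "(v, w) \<in> R\<^sup>*" "v \<notin> U" "w \<in> U"
  shows "\<exists>a b. (a, b) \<in> R \<and> a \<notin> U \<and> b \<in> U"
  using assms(1,3)
proof (induction rule: rtrancl_induct)
  case base
  then show ?case
    using assms(2) by simp
next
  case (step a b)
  then show ?case
    by (cases "a \<in> U") auto
qed

text \<open>Take a maximal set \<open>U\<close> whose nodes are matched to distinct incident edges
  inside \<open>U\<close>. If a node is missing, its component has a cycle. A cycle disjoint from
  \<open>U\<close> can be added to \<open>U\<close>; if it meets \<open>U\<close>, a path from the
  missing node enters \<open>U\<close> through an edge that can be matched to its outer end.\<close>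

lemma pseudoforest_imp_matching:
  fixes G :: "('v, 'e) multigraph"
  assumes fin: "finite (nodes G)" and sub: "\<And>e. e \<in> edges G \<Longrightarrow> set_uprod (ends G e) \<subseteq> nodes G"
    and pf: "pseudoforest G"
  shows "\<exists>\<phi>. inj_on \<phi> (nodes G) \<and> (\<forall>v\<in>nodes G. \<phi> v \<in> edges G \<and> v \<in> set_uprod (ends G (\<phi> v)))"
proof -
  define P where "P = (\<lambda>U \<phi>. U \<subseteq> nodes G \<and> inj_on \<phi> U \<and>
    (\<forall>v\<in>U. \<phi> v \<in> edges G \<and> v \<in> set_uprod (ends G (\<phi> v)) \<and> set_uprod (ends G (\<phi> v)) \<subseteq> U))"
  let ?\<U> = "{U. \<exists>\<phi>. P U \<phi>}"
  have "finite ?\<U>"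
    by (rule finite_subset[of _ "Pow (nodes G)"]) (use fin in \<open>auto simp: P_def\<close>)
  moreover have "{} \<in> ?\<U>"
    by (simp add: P_def)
  ultimately obtain U where U: "U \<in> ?\<U>" and max: "\<And>U'. U' \<in> ?\<U> \<Longrightarrow> U \<subseteq> U' \<Longrightarrow> U = U'"
    using finite_has_maximal[of ?\<U>] by blast
  then obtain \<phi> where \<phi>: "P U \<phi>"
    by blast
  have "U = nodes G"
  proof (rule ccontr)
    assume "U \<noteq> nodes G"
    then obtain v where v: "v \<in> nodes G" "v \<notin> U"
      using \<phi> by (auto simp: P_def)
    define K where "K = {w. (v, w) \<in> (adjacency G)\<^sup>*}"
    have "K \<in> components G"
      using v by (auto simp: components_def K_def)
    then obtain C where C: "is_cycle G C" "C \<subseteq> edges_within G K"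
      using pf unfolding pseudoforest_def by blast
    obtain vs es where c: "es \<noteq> []" "length vs = length es" "distinct vs" "distinct es"
      "set vs \<subseteq> nodes G" "set es \<subseteq> edges G" "C = set es"
      and inc: "\<And>i. i < length es \<Longrightarrow> ends G (es ! i) = Upair (vs ! i) (vs ! (Suc i mod length es))"
      using C(1) unfolding is_cycle_def by blast
    show False
    proof (cases "set vs \<inter> U = {}")
      case True
      \<comment> \<open>Each node of the cycle receives the edge that leaves it in the order of the
        walk.\<close>
      define \<phi>2 where "\<phi>2 = (\<lambda>x. the (map_of (zip vs es) x))"
      have \<phi>2: "\<phi>2 (vs ! i) = es ! i" if "i < length es" for i
        using that c by (simp add: \<phi>2_def map_of_zip_nth)
      define \<phi>1 where "\<phi>1 = (\<lambda>x. if x \<in> U then \<phi> x else \<phi>2 x)"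
      have incident: "\<phi>2 x \<in> edges G \<and> x \<in> set_uprod (ends G (\<phi>2 x)) \<and> set_uprod (ends G (\<phi>2 x)) \<subseteq> set vs"
        if x: "x \<in> set vs" for x
      proof -
        obtain i where i: "i < length es" "x = vs ! i"
          using x c(2) by (auto simp: in_set_conv_nth)
        have "Suc i mod length es < length vs"
          using i c by (metis mod_less_divisor length_greater_0_conv)
        then show ?thesis
          using i \<phi>2[OF i(1)] inc[OF i(1)] c by (auto intro: nth_mem)
      qed
      have "inj_on \<phi>2 (set vs)"
        using \<phi>2 c(2,4) by (auto simp: inj_on_def in_set_conv_nth nth_eq_iff_index_eq)
      moreover have "\<phi> x \<noteq> \<phi>2 z" if "x \<in> U" "z \<in> set vs" for x z
        using that incident[OF that(2)] \<phi> True unfolding P_def by (metis IntI empty_iff subsetD)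
      ultimately have "inj_on \<phi>1 (U \<union> set vs)"
        using \<phi> True unfolding P_def \<phi>1_def inj_on_def by (metis (no_types, lifting) Un_iff)
      then have "P (U \<union> set vs) \<phi>1"
        using \<phi> incident c(5) True unfolding P_def \<phi>1_def by auto
      then have "U = U \<union> set vs"
        by (intro max) auto
      then show False
        using True c(1,2) by (cases vs) auto
    next
      case False
      then obtain w where w: "w \<in> set vs" "w \<in> U"
        by blast
      then obtain i where i: "i < length es" "w = vs ! i"
        using c(2) by (auto simp: in_set_conv_nth)
      then have "es ! i \<in> edges_within G K"
        using C(2) c(7) by auto
      then have "w \<in> K"
        using inc[OF i(1)] i(2) by (simp add: edges_within_def)
      then obtain a b where ab: "(a, b) \<in> adjacency G" "a \<notin> U" "b \<in> U"
        using rtrancl_crossing[of v w "adjacency G" U] v w by (auto simp: K_def)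
      then obtain e where e: "e \<in> edges G" "ends G e = Upair a b"
        by (auto simp: adjacency_def)
      \<comment> \<open>The last clause of \<open>P\<close> keeps both ends of a matched edge in
        \<open>U\<close>, but \<open>a\<close> lies outside.\<close>
      have "e \<notin> \<phi> ` U"
        using \<phi> e ab(2) by (auto simp: P_def)
      then have "inj_on (\<phi>(a := e)) (insert a U)"
        using \<phi> ab(2) by (auto simp: P_def inj_on_def)
      moreover have "a \<in> nodes G"
        using sub[OF e(1)] e(2) by simp
      ultimately have "P (insert a U) (\<phi>(a := e))"
        using \<phi> ab e unfolding P_def by auto
      then have "U = insert a U"
        by (intro max) auto
      then show False
        using ab(2) by blast
    qed
  qed
  then show ?thesis
    using \<phi> by (auto simp: P_def)
qed

definition orientations :: "nat \<Rightarrow> 'a set \<Rightarrow> ('a \<times> bit \<Rightarrow> nat) \<Rightarrow> ('a \<Rightarrow> bit) set" where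
  "orientations n S q = {y \<in> S \<rightarrow>\<^sub>E UNIV. bij_betw (\<lambda>j. q (j, y j)) S {1..n}}"

text \<open>There are as many edges as nodes, so a matching of nodes with incident edges is a
  bijection and its inverse names the heads. Conversely, an orientation supplies the heads
  \<open>q (j, y j)\<close> and the tails \<open>q (j, y j + 1)\<close>, as adding 1 switches the
  label.\<close>

lemma pseudoforest_iff_orientations:
  assumes S: "finite S" "card S = n" and q: "q \<in> S \<times> {0, 1} \<rightarrow>\<^sub>E {1..n}"
  shows "pseudoforest (G_of n S q) \<longleftrightarrow> orientations n S q \<noteq> {}"
proof
  let ?G = "G_of n S q"
  have qin: "q (j, x) \<in> {1..n}" if "j \<in> S" for j x
    using q that by (cases x) auto
  assume "pseudoforest ?G"
  then obtain \<phi> where \<phi>: "inj_on \<phi> {1..n}" "\<And>v. v \<in> {1..n} \<Longrightarrow> \<phi> v \<in> S"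
    "\<And>v. v \<in> {1..n} \<Longrightarrow> v = q (\<phi> v, 0) \<or> v = q (\<phi> v, 1)"
    using pseudoforest_imp_matching[of ?G] qin by (auto simp: G_of_def)
  have "\<phi> ` {1..n} = S"
    by (rule card_subset_eq) (use \<phi> S in \<open>auto simp: card_image\<close>)
  then have bij: "bij_betw \<phi> {1..n} S"
    using \<phi>(1) by (simp add: bij_betw_def)
  let ?t = "inv_into {1..n} \<phi>"
  have t: "?t j \<in> {1..n}" "\<phi> (?t j) = j" if "j \<in> S" for j
    using that bij by (auto simp: bij_betw_def inv_into_into f_inv_into_f)
  define y :: "'a \<Rightarrow> bit" where "y = restrict (\<lambda>j. if q (j, 0) = ?t j then 0 else 1) S"
  have "q (j, y j) = ?t j" if "j \<in> S" for j
    using that \<phi>(3)[OF t(1)[OF that]] t(2)[OF that] by (auto simp: y_def)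
  then have "bij_betw (\<lambda>j. q (j, y j)) S {1..n}"
    using bij_betw_inv_into[OF bij] by (simp cong: bij_betw_cong)
  moreover have "y \<in> S \<rightarrow>\<^sub>E UNIV"
    by (simp add: y_def)
  ultimately show "orientations n S q \<noteq> {}"
    unfolding orientations_def by blast
next
  let ?G = "G_of n S q"
  have qin: "q (j, x) \<in> {1..n}" if "j \<in> S" for j x
    using q that by (cases x) auto
  assume "orientations n S q \<noteq> {}"
  then obtain y where y: "bij_betw (\<lambda>j. q (j, y j)) S {1..n}"
    unfolding orientations_def by blast
  show "pseudoforest ?G"
  proof (rule oriented_imp_pseudoforest[where g = "\<lambda>j. q (j, y j)" and h = "\<lambda>j. q (j, y j + 1)"])
    show "finite (nodes ?G)"
      by (simp add: G_of_def)
    show "bij_betw (\<lambda>j. q (j, y j)) (edges ?G) (nodes ?G)"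
      using y by (simp add: G_of_def)
    show "(\<lambda>j. q (j, y j + 1)) \<in> edges ?G \<rightarrow> nodes ?G"
      using qin by (simp add: G_of_def)
    show "ends ?G e = Upair (q (e, y e)) (q (e, y e + 1))" for e
      by (cases "y e") (auto simp: G_of_def Upair_inject)
  qed
qed

section \<open>Images of a random matrix\<close>

text \<open>The second moment method in counting form: each value in \<open>Y\<close> is taken with
  probability \<open>1 / N\<close>, pairwise independently. The number \<open>Z\<close> of hits has
  mean \<open>E\<close> and second moment at most E + E^2, so by Cauchy-Schwarz it is positive with
  probability at least E / (1 + E). This is at least 1/3 because E is at least 1/2.\<close>

lemma second_moment_count:
  fixes \<Omega> :: "'h set" and X :: "'x set" and Y :: "'y set" and act :: "'h \<Rightarrow> 'x \<Rightarrow> 'y" and N :: real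
  assumes fin: "finite \<Omega>" "finite X" "finite Y" and N: "N > 0"
    and one: "\<And>x y. x \<in> X \<Longrightarrow> y \<in> Y \<Longrightarrow> real (card {H \<in> \<Omega>. act H x = y}) = card \<Omega> / N"
    and two: "\<And>x x' y y'. x \<in> X \<Longrightarrow> x' \<in> X \<Longrightarrow> x \<noteq> x' \<Longrightarrow> y \<in> Y \<Longrightarrow> y' \<in> Y \<Longrightarrow>
      real (card {H \<in> \<Omega>. act H x = y \<and> act H x' = y'}) = card \<Omega> / N\<^sup>2"
    and big: "N \<le> 2 * (real (card X) * real (card Y))"
  shows "real (card \<Omega>) \<le> 3 * real (card {H \<in> \<Omega>. \<exists>x\<in>X. act H x \<in> Y})"
proof (cases "card \<Omega> = 0")
  case False
  define h where "h = real (card \<Omega>)"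
  define E where "E = real (card X) * real (card Y) / N"
  define hit where "hit = (\<lambda>H x. of_bool (act H x \<in> Y) :: real)"
  define Z where "Z = (\<lambda>H. \<Sum>x\<in>X. hit H x)"
  define G where "G = {H \<in> \<Omega>. \<exists>x\<in>X. act H x \<in> Y}"
  have h: "h > 0"
    using False by (simp add: h_def)
  have E: "1/2 \<le> E"
    using big N by (simp add: E_def field_simps)
  have hit_sum: "hit H x = (\<Sum>y\<in>Y. of_bool (act H x = y))" for H x
    using fin(3) by (simp add: hit_def of_bool_def)
  have count: "(\<Sum>H\<in>\<Omega>. of_bool (Q H)) = real (card {H \<in> \<Omega>. Q H})" for Q
    using fin(1) by (simp add: Int_def)
  have S1: "(\<Sum>H\<in>\<Omega>. hit H x) = real (card Y) * h / N" if "x \<in> X" for x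
  proof -
    have "(\<Sum>H\<in>\<Omega>. hit H x) = (\<Sum>y\<in>Y. \<Sum>H\<in>\<Omega>. of_bool (act H x = y))"
      unfolding hit_sum by (rule sum.swap)
    also have "\<dots> = (\<Sum>y\<in>Y. h / N)"
      by (rule sum.cong[OF refl]) (simp only: count one[OF that] h_def)
    finally show ?thesis by simp
  qed
  have S2: "(\<Sum>H\<in>\<Omega>. hit H x * hit H x') = (real (card Y))\<^sup>2 * h / N\<^sup>2"
    if "x \<in> X" "x' \<in> X" "x \<noteq> x'" for x x'
  proof -
    have "(\<Sum>H\<in>\<Omega>. hit H x * hit H x') = (\<Sum>H\<in>\<Omega>. \<Sum>y\<in>Y. \<Sum>y'\<in>Y. of_bool (act H x = y \<and> act H x' = y'))"
      unfolding hit_sum sum_product by (simp only: of_bool_conj)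
    also have "\<dots> = (\<Sum>y\<in>Y. \<Sum>H\<in>\<Omega>. \<Sum>y'\<in>Y. of_bool (act H x = y \<and> act H x' = y'))"
      by (rule sum.swap)
    also have "\<dots> = (\<Sum>y\<in>Y. \<Sum>y'\<in>Y. \<Sum>H\<in>\<Omega>. of_bool (act H x = y \<and> act H x' = y'))"
      by (intro sum.cong refl sum.swap)
    also have "\<dots> = (\<Sum>y\<in>Y. \<Sum>y'\<in>Y. h / N\<^sup>2)"
      by (intro sum.cong refl) (simp only: count two[OF that] h_def)
    finally show ?thesis by (simp add: power2_eq_square)
  qed
  have "(\<Sum>H\<in>\<Omega>. Z H) = (\<Sum>x\<in>X. \<Sum>H\<in>\<Omega>. hit H x)"
    unfolding Z_def by (rule sum.swap)
  also have "\<dots> = (\<Sum>x\<in>X. real (card Y) * h / N)"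
    by (intro sum.cong refl) (simp only: S1)
  finally have EZ: "(\<Sum>H\<in>\<Omega>. Z H) = h * E"
    by (simp add: E_def)
  have "(\<Sum>H\<in>\<Omega>. (Z H)\<^sup>2) = (\<Sum>H\<in>\<Omega>. \<Sum>x\<in>X. \<Sum>x'\<in>X. hit H x * hit H x')"
    unfolding Z_def power2_eq_square sum_product ..
  also have "\<dots> = (\<Sum>x\<in>X. \<Sum>H\<in>\<Omega>. \<Sum>x'\<in>X. hit H x * hit H x')"
    by (rule sum.swap)
  also have "\<dots> = (\<Sum>x\<in>X. \<Sum>x'\<in>X. \<Sum>H\<in>\<Omega>. hit H x * hit H x')"
    by (intro sum.cong refl sum.swap)
  \<comment> \<open>The second summand is the exact value for distinct \<open>x\<close> and
    \<open>x'\<close>. Adding it on the diagonal as well only enlarges the bound and lets the sum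
    factor.\<close>
  also have "\<dots> \<le> (\<Sum>x\<in>X. \<Sum>x'\<in>X. of_bool (x' = x) * (real (card Y) * h / N)
      + (real (card Y))\<^sup>2 * h / N\<^sup>2)"
  proof (intro sum_mono)
    fix x x' assume x: "x \<in> X" "x' \<in> X"
    show "(\<Sum>H\<in>\<Omega>. hit H x * hit H x') \<le> of_bool (x' = x) * (real (card Y) * h / N)
      + (real (card Y))\<^sup>2 * h / N\<^sup>2"
    proof (cases "x' = x")
      case True
      have "(\<Sum>H\<in>\<Omega>. hit H x * hit H x') = (\<Sum>H\<in>\<Omega>. hit H x)"
        unfolding True by (intro sum.cong refl) (simp add: hit_def)
      then show ?thesis
        using S1[OF x(1)] True h by simp
    next
      case False
      then show ?thesis
        using S2[OF x] by simp
    qed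
  qed
  also have "\<dots> = (\<Sum>x\<in>X. real (card Y) * h / N + real (card X) * ((real (card Y))\<^sup>2 * h / N\<^sup>2))"
  proof (intro sum.cong refl)
    fix x assume "x \<in> X"
    then have "(\<Sum>x'\<in>X. of_bool (x' = x) * c) = c" for c :: real
      using fin(2) by (simp add: of_bool_def flip: sum_distrib_right)
    then show "(\<Sum>x'\<in>X. of_bool (x' = x) * (real (card Y) * h / N) + (real (card Y))\<^sup>2 * h / N\<^sup>2)
        = real (card Y) * h / N + real (card X) * ((real (card Y))\<^sup>2 * h / N\<^sup>2)"
      by (simp only: sum.distrib sum_constant)
  qed
  also have "\<dots> = h * (E + E\<^sup>2)"
    using N by (simp add: E_def field_simps power2_eq_square)
  finally have EZ2: "(\<Sum>H\<in>\<Omega>. (Z H)\<^sup>2) \<le> h * (E + E\<^sup>2)" .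
  \<comment> \<open>\<open>Z\<close> vanishes off \<open>G\<close>, so Cauchy-Schwarz can be applied
    to \<open>Z\<close> and the indicator of \<open>G\<close>.\<close>
  have "Z H = Z H * of_bool (H \<in> G)" if "H \<in> \<Omega>" for H
    using that by (auto simp: Z_def G_def hit_def)
  then have "(\<Sum>H\<in>\<Omega>. Z H) = (\<Sum>H\<in>\<Omega>. Z H * of_bool (H \<in> G))"
    by (intro sum.cong refl)
  then have "(\<Sum>H\<in>\<Omega>. Z H)\<^sup>2 \<le> (\<Sum>H\<in>\<Omega>. (Z H)\<^sup>2) * (\<Sum>H\<in>\<Omega>. (of_bool (H \<in> G))\<^sup>2)"
    using Cauchy_Schwarz_ineq_sum[of Z "\<lambda>H. of_bool (H \<in> G)" \<Omega>] by simp
  also have "(\<Sum>H\<in>\<Omega>. (of_bool (H \<in> G))\<^sup>2) = (\<Sum>H\<in>\<Omega>. of_bool (H \<in> G) :: real)"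
    by (intro sum.cong refl) simp
  also have "\<dots> = real (card G)"
    unfolding count by (rule arg_cong[where f = "\<lambda>A. real (card A)"]) (auto simp: G_def)
  also have "(\<Sum>H\<in>\<Omega>. (Z H)\<^sup>2) * real (card G) \<le> h * (E + E\<^sup>2) * real (card G)"
    using EZ2 by (rule mult_right_mono) simp
  finally have "(h * E) * (h * E) \<le> (h * E) * ((1 + E) * real (card G))"
    unfolding EZ by (simp add: power2_eq_square algebra_simps)
  then have le: "h * E \<le> (1 + E) * real (card G)"
    using h E by (simp add: mult_le_cancel_left_pos)
  have "h * (1 + E) \<le> 3 * (h * E)"
    using h E by (simp add: algebra_simps)
  also have "\<dots> \<le> (1 + E) * (3 * real (card G))"
    using le by (simp add: algebra_simps)
  finally have "(1 + E) * h \<le> (1 + E) * (3 * real (card G))"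
    by (simp add: mult.commute)
  then have "h \<le> 3 * real (card G)"
    using E by (simp add: mult_le_cancel_left_pos)
  then show ?thesis
    by (simp add: h_def G_def)
qed simp

section \<open>Inner products over the field with two elements\<close>

lemma bit_add_eq_0_iff: "(a::bit) + b = 0 \<longleftrightarrow> a = b"
  by (cases a; cases b) auto

text \<open>Flipping a coordinate at which \<open>x\<close> is 1 is an involution that changes the
  inner product by 1.\<close>

lemma card_inner_product_eq:
  fixes x :: "'k \<Rightarrow> bit"
  assumes B: "finite B" and x: "\<exists>k\<in>B. x k \<noteq> 0"
  shows "card {r \<in> B \<rightarrow>\<^sub>E UNIV. (\<Sum>k\<in>B. r k * x k) = 0} =
    card {r \<in> B \<rightarrow>\<^sub>E UNIV. (\<Sum>k\<in>B. r k * x k) = 1}"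
proof -
  obtain k where k: "k \<in> B" "x k = 1"
    using x by auto
  define flip where "flip = (\<lambda>r :: 'k \<Rightarrow> bit. r(k := r k + 1))"
  have ff: "flip (flip r) = r" for r
    by (cases "r k") (simp_all add: flip_def fun_upd_idem)
  have PiE: "flip r \<in> B \<rightarrow>\<^sub>E UNIV" if "r \<in> B \<rightarrow>\<^sub>E UNIV" for r
    using that k by (auto simp: flip_def PiE_iff extensional_def)
  have sum: "(\<Sum>l\<in>B. flip r l * x l) = (\<Sum>l\<in>B. r l * x l) + 1" for r
  proof -
    have "(\<Sum>l\<in>B. flip r l * x l) = (\<Sum>l\<in>B. r l * x l + of_bool (l = k))"
      using k by (intro sum.cong refl) (auto simp: flip_def algebra_simps)
    also have "\<dots> = (\<Sum>l\<in>B. r l * x l) + (\<Sum>l\<in>B. of_bool (l = k))"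
      by (rule sum.distrib)
    also have "(\<Sum>l\<in>B. of_bool (l = k)) = (1 :: bit)"
      using B k by (simp add: of_bool_def)
    finally show ?thesis .
  qed
  define ip where "ip = (\<lambda>r. \<Sum>k\<in>B. r k * x k)"
  have "ip (flip r) = ip r + 1" for r
    unfolding ip_def by (rule sum)
  then have "bij_betw flip {r \<in> B \<rightarrow>\<^sub>E UNIV. ip r = 0} {r \<in> B \<rightarrow>\<^sub>E UNIV. ip r = 1}"
    by (intro bij_betw_byWitness[where f' = flip]) (auto simp: ff intro!: PiE)
  then show ?thesis
    unfolding ip_def by (rule bij_betw_same_card)
qed

lemma card_bit_functions:
  assumes "finite B"
  shows "card (B \<rightarrow>\<^sub>E (UNIV :: bit set)) = 2 ^ card B"
proof -
  have "(UNIV :: bit set) = {0, 1}"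
    by (auto intro: bit.exhaust)
  then have "card (UNIV :: bit set) = card {0, 1 :: bit}"
    by (simp only:)
  then show ?thesis
    using assms by (simp add: card_PiE numeral_2_eq_2)
qed

lemma finite_bit_functions:
  assumes "finite B"
  shows "finite (B \<rightarrow>\<^sub>E (UNIV :: bit set))"
proof -
  have "(UNIV :: bit set) = {0, 1}"
    by (auto intro: bit.exhaust)
  then have "finite (UNIV :: bit set)"
    by (metis finite.emptyI finite.insertI)
  then show ?thesis
    using assms by (intro finite_PiE) auto
qed

lemma card_split_bit:
  fixes F :: "'r \<Rightarrow> bit"
  assumes "finite R"
  shows "card R = card {r \<in> R. F r = 0} + card {r \<in> R. F r = 1}"
proof -
  have "R = {r \<in> R. F r = 0} \<union> {r \<in> R. F r = 1}"
    by auto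
  then show ?thesis
    using assms by (subst card_Un_disjoint[symmetric]) auto
qed

lemma card_inner_product:
  fixes x :: "'k \<Rightarrow> bit"
  assumes B: "finite B" and x: "\<exists>k\<in>B. x k \<noteq> 0"
  shows "2 * card {r \<in> B \<rightarrow>\<^sub>E UNIV. (\<Sum>k\<in>B. r k * x k) = s} = 2 ^ card B"
  using card_inner_product_eq[OF assms] card_bit_functions[OF B]
    card_split_bit[OF finite_bit_functions[OF B], of "\<lambda>r. \<Sum>k\<in>B. r k * x k"]
  by (cases s) simp_all

text \<open>The four joint counts are equal because each of the vectors \<open>x\<close>, \<open>x'\<close> and \<open>x + x'\<close> is nonzero.\<close>

lemma card_inner_product_pair:
  fixes x x' :: "'k \<Rightarrow> bit"
  assumes B: "finite B" and x: "\<exists>k\<in>B. x k \<noteq> 0" and x': "\<exists>k\<in>B. x' k \<noteq> 0"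
    and ne: "\<exists>k\<in>B. x k \<noteq> x' k"
  shows "4 * card {r \<in> B \<rightarrow>\<^sub>E UNIV. (\<Sum>k\<in>B. r k * x k) = s \<and> (\<Sum>k\<in>B. r k * x' k) = t} = 2 ^ card B"
proof -
  let ?R = "B \<rightarrow>\<^sub>E (UNIV :: bit set)"
  define u where "u = (\<lambda>r. \<Sum>k\<in>B. r k * x k)"
  define v where "v = (\<lambda>r. \<Sum>k\<in>B. r k * x' k)"
  define c where "c = (\<lambda>a b. card {r \<in> ?R. u r = a \<and> v r = b})"
  have fin: "finite {r \<in> ?R. Q r}" for Q
    using finite_bit_functions[OF B] by simp
  have u: "2 * card {r \<in> ?R. u r = a} = 2 ^ card B" for a
    unfolding u_def by (rule card_inner_product[OF B x])
  have v: "2 * card {r \<in> ?R. v r = a} = 2 ^ card B" for a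
    unfolding v_def by (rule card_inner_product[OF B x'])
  have "(\<Sum>k\<in>B. r k * (x k + x' k)) = u r + v r" for r
    by (simp only: u_def v_def sum.distrib distrib_left)
  moreover have "\<exists>k\<in>B. x k + x' k \<noteq> 0"
    using ne by (simp only: bit_add_eq_0_iff)
  ultimately have w: "2 * card {r \<in> ?R. u r + v r = 0} = 2 ^ card B"
    using card_inner_product[OF B, of "\<lambda>k. x k + x' k" 0] by simp
  have "card {r \<in> ?R. u r = a} = c a 0 + c a 1" for a
    using card_split_bit[OF fin, of "\<lambda>r. u r = a" v] by (simp add: c_def conj_ac)
  moreover have "card {r \<in> ?R. v r = a} = c 0 a + c 1 a" for a
    using card_split_bit[OF fin, of "\<lambda>r. v r = a" u] by (simp add: c_def conj_ac)
  moreover have "card {r \<in> ?R. u r + v r = 0} = c 0 0 + c 1 1"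
  proof -
    have "{r \<in> {r \<in> ?R. u r + v r = 0}. u r = a} = {r \<in> ?R. u r = a \<and> v r = a}" for a
      by (auto simp: bit_add_eq_0_iff)
    then show ?thesis
      using card_split_bit[OF fin, of "\<lambda>r. u r + v r = 0" u] by (simp only: c_def)
  qed
  \<comment> \<open>The rows, the columns and the diagonal of the two-by-two table \<open>c\<close>
    all have the sum \<open>2 ^ card B / 2\<close>, which forces its four entries to agree.\<close>
  ultimately have "4 * c s t = 2 ^ card B"
    using u[of 0] u[of 1] v[of 0] v[of 1] w by (cases s; cases t) auto
  then show ?thesis
    by (simp add: c_def u_def v_def)
qed

text \<open>A matrix is the same as the family of its rows, so the counts for conditions on single
  rows multiply.\<close>

lemma card_rows:
  assumes S: "finite S"
  shows "card {H \<in> S \<times> B \<rightarrow>\<^sub>E UNIV. \<forall>j\<in>S. (\<lambda>k\<in>B. H (j, k)) \<in> R j} =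
    (\<Prod>j\<in>S. card {r \<in> B \<rightarrow>\<^sub>E UNIV. r \<in> R j})"
proof -
  have "bij_betw (\<lambda>H. \<lambda>j\<in>S. \<lambda>k\<in>B. H (j, k))
      {H \<in> S \<times> B \<rightarrow>\<^sub>E UNIV. \<forall>j\<in>S. (\<lambda>k\<in>B. H (j, k)) \<in> R j}
      (\<Pi>\<^sub>E j\<in>S. {r \<in> B \<rightarrow>\<^sub>E UNIV. r \<in> R j})"
  proof (rule bij_betw_byWitness[where f' = "\<lambda>r. \<lambda>p\<in>S \<times> B. r (fst p) (snd p)"])
    show "\<forall>H\<in>{H \<in> S \<times> B \<rightarrow>\<^sub>E UNIV. \<forall>j\<in>S. (\<lambda>k\<in>B. H (j, k)) \<in> R j}.
        (\<lambda>p\<in>S \<times> B. (\<lambda>j\<in>S. \<lambda>k\<in>B. H (j, k)) (fst p) (snd p)) = H"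
      by (auto simp: fun_eq_iff PiE_iff extensional_def restrict_def)
    have inv: "(\<lambda>k\<in>B. (\<lambda>p\<in>S \<times> B. r (fst p) (snd p)) (j, k)) = r j"
      if "r \<in> (\<Pi>\<^sub>E j\<in>S. {r \<in> B \<rightarrow>\<^sub>E UNIV. r \<in> R j})" "j \<in> S" for r :: "'a \<Rightarrow> 'b \<Rightarrow> 'c" and j
    proof -
      have "r j \<in> extensional B"
        using PiE_mem[OF that] by (auto simp: PiE_iff)
      then show ?thesis
        using that(2) by (auto simp: fun_eq_iff extensional_def restrict_def)
    qed
    show "\<forall>r\<in>\<Pi>\<^sub>E j\<in>S. {r \<in> B \<rightarrow>\<^sub>E UNIV. r \<in> R j}.
        (\<lambda>j\<in>S. \<lambda>k\<in>B. (\<lambda>p\<in>S \<times> B. r (fst p) (snd p)) (j, k)) = r"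
    proof
      fix r assume r: "r \<in> (\<Pi>\<^sub>E j\<in>S. {r \<in> B \<rightarrow>\<^sub>E UNIV. r \<in> R j})"
      then have "r j = undefined" if "j \<notin> S" for j
        using that by (rule PiE_arb)
      then have "(\<lambda>j\<in>S. \<lambda>k\<in>B. (\<lambda>p\<in>S \<times> B. r (fst p) (snd p)) (j, k)) j = r j" for j
        using inv[OF r, of j] by (subst restrict_apply) (cases "j \<in> S", simp_all only: if_True if_False simp_thms not_False_eq_True)
      then show "(\<lambda>j\<in>S. \<lambda>k\<in>B. (\<lambda>p\<in>S \<times> B. r (fst p) (snd p)) (j, k)) = r"
        by (rule ext)
    qed
    show "(\<lambda>H. \<lambda>j\<in>S. \<lambda>k\<in>B. H (j, k)) ` {H \<in> S \<times> B \<rightarrow>\<^sub>E UNIV. \<forall>j\<in>S. (\<lambda>k\<in>B. H (j, k)) \<in> R j}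
        \<subseteq> (\<Pi>\<^sub>E j\<in>S. {r \<in> B \<rightarrow>\<^sub>E UNIV. r \<in> R j})"
      by auto
    show "(\<lambda>r. \<lambda>p\<in>S \<times> B. r (fst p) (snd p)) ` (\<Pi>\<^sub>E j\<in>S. {r \<in> B \<rightarrow>\<^sub>E UNIV. r \<in> R j})
        \<subseteq> {H \<in> S \<times> B \<rightarrow>\<^sub>E UNIV. \<forall>j\<in>S. (\<lambda>k\<in>B. H (j, k)) \<in> R j}"
    proof (intro image_subsetI CollectI conjI ballI)
      fix r j assume r: "r \<in> (\<Pi>\<^sub>E j\<in>S. {r \<in> B \<rightarrow>\<^sub>E UNIV. r \<in> R j})" and j: "j \<in> S"
      show "(\<lambda>k\<in>B. (\<lambda>p\<in>S \<times> B. r (fst p) (snd p)) (j, k)) \<in> R j"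
        unfolding inv[OF r j] using PiE_mem[OF r j] by simp
    qed simp
  qed
  then show ?thesis
    using S by (simp add: bij_betw_same_card card_PiE)
qed

text \<open>Distinct nonzero vectors over the field with two elements are linearly independent, so
  their images under a uniform \<open>H\<close> are uniform and independent, and the second moment
  bound applies with \<open>N = 2 ^ card S\<close>. The zero vector has a constant image and is left
  out. Since \<open>B\<close> is nonempty this loses at most half of all \<open>x\<close>, which
  accounts for the factor 2 in the size condition of that bound.\<close>

lemma card_matrices_hitting:
  fixes Y :: "('a \<Rightarrow> bit) set"
  assumes S: "finite S" and B: "finite B" "B \<noteq> {}" and Y: "Y \<subseteq> S \<rightarrow>\<^sub>E UNIV"
    and big: "2 ^ card S \<le> 2 ^ card B * card Y"
  shows "real (card (S \<times> B \<rightarrow>\<^sub>E (UNIV :: bit set))) \<le>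
    3 * real (card {H \<in> S \<times> B \<rightarrow>\<^sub>E UNIV. \<exists>x\<in>B \<rightarrow>\<^sub>E UNIV. restrict (mat_vec B H x) S \<in> Y})"
proof -
  let ?\<Omega> = "S \<times> B \<rightarrow>\<^sub>E (UNIV :: bit set)"
  define X where "X = {x \<in> B \<rightarrow>\<^sub>E (UNIV :: bit set). \<exists>k\<in>B. x k \<noteq> 0}"
  define act where "act = (\<lambda>H x. restrict (mat_vec B H x) S)"
  have fin: "finite ?\<Omega>" "finite X" "finite Y"
    using S B finite_subset[OF Y] by (auto simp: X_def finite_bit_functions)
  have card\<Omega>: "real (card ?\<Omega>) = (2 ^ card B) ^ card S"
    using S B by (simp add: card_bit_functions card_cartesian_product power_mult[symmetric] mult.commute)
  have act_eq: "act H x = y \<longleftrightarrow> (\<forall>j\<in>S. (\<lambda>k\<in>B. H (j, k)) \<in> {r. (\<Sum>k\<in>B. r k * x k) = y j})"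
    if "y \<in> S \<rightarrow>\<^sub>E UNIV" for H x y
    using that by (auto simp: act_def mat_vec_def fun_eq_iff PiE_iff extensional_def)
  have one: "real (card {H \<in> ?\<Omega>. act H x = y}) = real (card ?\<Omega>) / 2 ^ card S"
    if "x \<in> X" "y \<in> Y" for x y
  proof -
    have y: "y \<in> S \<rightarrow>\<^sub>E UNIV"
      using that Y by blast
    have "real (card {r \<in> B \<rightarrow>\<^sub>E UNIV. (\<Sum>k\<in>B. r k * x k) = s}) = 2 ^ card B / 2" for s
    proof -
      have "2 * card {r \<in> B \<rightarrow>\<^sub>E UNIV. (\<Sum>k\<in>B. r k * x k) = s} = 2 ^ card B"
        using card_inner_product[OF B(1), of x s] that(1) by (simp add: X_def)
      then have "real (2 * card {r \<in> B \<rightarrow>\<^sub>E UNIV. (\<Sum>k\<in>B. r k * x k) = s}) = real (2 ^ card B)"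
        by (simp only:)
      then show ?thesis by simp
    qed
    then show ?thesis
      unfolding act_eq[OF y] card_rows[OF S] card\<Omega>
      by (simp only: of_nat_prod mem_Collect_eq prod_constant power_divide)
  qed
  have two: "real (card {H \<in> ?\<Omega>. act H x = y \<and> act H x' = y'}) = real (card ?\<Omega>) / (2 ^ card S)\<^sup>2"
    if x: "x \<in> X" "x' \<in> X" "x \<noteq> x'" and "y \<in> Y" "y' \<in> Y" for x x' y y'
  proof -
    have y: "y \<in> S \<rightarrow>\<^sub>E UNIV" "y' \<in> S \<rightarrow>\<^sub>E UNIV"
      using that Y by blast+
    have ne: "\<exists>k\<in>B. x k \<noteq> x' k"
      using x by (auto simp: X_def) (metis PiE_ext)
    have "real (card {r \<in> B \<rightarrow>\<^sub>E UNIV. (\<Sum>k\<in>B. r k * x k) = s \<and> (\<Sum>k\<in>B. r k * x' k) = t})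
        = 2 ^ card B / 4" for s t
    proof -
      have "4 * card {r \<in> B \<rightarrow>\<^sub>E UNIV. (\<Sum>k\<in>B. r k * x k) = s \<and> (\<Sum>k\<in>B. r k * x' k) = t} = 2 ^ card B"
        using card_inner_product_pair[OF B(1), of x x' s t] x ne by (simp add: X_def)
      then have "real (4 * card {r \<in> B \<rightarrow>\<^sub>E UNIV. (\<Sum>k\<in>B. r k * x k) = s \<and> (\<Sum>k\<in>B. r k * x' k) = t})
          = real (2 ^ card B)"
        by (simp only:)
      then show ?thesis by simp
    qed
    moreover have rows: "{H \<in> ?\<Omega>. act H x = y \<and> act H x' = y'} = {H \<in> ?\<Omega>. \<forall>j\<in>S. (\<lambda>k\<in>B. H (j, k)) \<in>
        {r. (\<Sum>k\<in>B. r k * x k) = y j \<and> (\<Sum>k\<in>B. r k * x' k) = y' j}}"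
      unfolding act_eq[OF y(1)] act_eq[OF y(2)] by blast
    moreover have "(2 ^ card S)\<^sup>2 = (4::real) ^ card S"
      by (simp add: power2_eq_square flip: power_mult_distrib)
    ultimately show ?thesis
      unfolding card\<Omega> rows card_rows[OF S]
      by (simp only: of_nat_prod mem_Collect_eq prod_constant power_divide)
  qed
  have "X = (B \<rightarrow>\<^sub>E UNIV) - {\<lambda>k\<in>B. 0}"
    by (auto simp: X_def fun_eq_iff PiE_iff extensional_def)
  then have "card X = 2 ^ card B - 1"
    using B by (simp add: card_bit_functions finite_bit_functions)
  moreover have "(2::nat) \<le> 2 ^ card B"
    using B by (metis card_gt_0_iff one_le_numeral power_increasing power_one_right Suc_leI One_nat_def)
  ultimately have "2 ^ card B \<le> 2 * card X"
    by simp
  then have "2 ^ card S \<le> 2 * card X * card Y"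
    using big by (meson le_trans mult_le_mono1)
  then have "real (2 ^ card S) \<le> real (2 * card X * card Y)"
    by (simp only: of_nat_le_iff)
  then have "2 ^ card S \<le> 2 * (real (card X) * real (card Y))"
    by simp
  then have "real (card ?\<Omega>) \<le> 3 * real (card {H \<in> ?\<Omega>. \<exists>x\<in>X. act H x \<in> Y})"
    using second_moment_count[OF fin, of "2 ^ card S" act] one two by simp
  also have "\<dots> \<le> 3 * real (card {H \<in> ?\<Omega>. \<exists>x\<in>B \<rightarrow>\<^sub>E UNIV. restrict (mat_vec B H x) S \<in> Y})"
    using fin(1) by (simp, intro card_mono) (auto simp: X_def act_def)
  finally show ?thesis .
qed

section \<open>Counting pairs of an edge labelling and an orientation\<close>

lemma of_nat_bit_eq_1_iff: "(of_nat k :: bit) = 1 \<longleftrightarrow> odd k"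
  by (induction k) auto

text \<open>The matrix entry is the sum modulo 2 of the indicators of both ends, so
  \<open>y = 1\<close> moves the head from label 0 to label 1.\<close>

lemma A_of_mult_add:
  "A_of q (i, j) * y + of_bool (q (j, 0) = i) = (of_bool (q (j, y) = i) :: bit)"
  by (cases y) (auto simp: A_of_def)

text \<open>Moving the count of ends with label 0 to the left side leaves the in-degree of
  \<open>i\<close> modulo 2 there and 1 on the right.\<close>

lemma mat_vec_A_of_eq_d_of_iff:
  assumes S: "finite S"
  shows "mat_vec S (A_of q) y i = d_of S q i \<longleftrightarrow> odd (card {j \<in> S. q (j, y j) = i})"
proof -
  have count: "(\<Sum>j\<in>S. of_bool (Q j)) = (of_nat (card {j \<in> S. Q j}) :: bit)" for Q
    using S by (simp add: of_bool_def sum.If_cases Int_def)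
  have "mat_vec S (A_of q) y i + of_nat (card {j \<in> S. q (j, 0) = i})
      = (of_nat (card {j \<in> S. q (j, y j) = i}) :: bit)"
    by (simp only: mat_vec_def case_prod_conv A_of_mult_add sum.distrib[symmetric] count[symmetric])
  moreover have "a = c + 1 \<longleftrightarrow> a + c = 1" for a c :: bit
    by (cases a; cases c) auto
  ultimately show ?thesis
    by (simp only: d_of_def of_nat_add of_nat_1 of_nat_bit_eq_1_iff)
qed

text \<open>Odd fibres are nonempty, so the map is onto, and equal cardinalities make it
  bijective.\<close>

lemma bij_betw_iff_odd_fibres:
  assumes S: "finite S" "card S = card V" and V: "finite V" and g: "g \<in> S \<rightarrow> V"
  shows "bij_betw g S V \<longleftrightarrow> (\<forall>i\<in>V. odd (card {j \<in> S. g j = i}))"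
proof
  assume bij: "bij_betw g S V"
  show "\<forall>i\<in>V. odd (card {j \<in> S. g j = i})"
  proof
    fix i assume "i \<in> V"
    then obtain j where "j \<in> S" "g j = i"
      using bij by (auto simp: bij_betw_def)
    then have "{j \<in> S. g j = i} = {j}"
      using bij by (auto simp: bij_betw_def inj_on_def)
    then show "odd (card {j \<in> S. g j = i})"
      by simp
  qed
next
  assume odd: "\<forall>i\<in>V. odd (card {j \<in> S. g j = i})"
  have "V \<subseteq> g ` S"
  proof
    fix i assume "i \<in> V"
    then have "card {j \<in> S. g j = i} \<noteq> 0"
      using odd by (metis even_zero)
    then have "{j \<in> S. g j = i} \<noteq> {}"
      by (metis card.empty)
    then show "i \<in> g ` S"
      by blast
  qed
  then have "g ` S = V"
    using g by blast
  moreover from this have "inj_on g S"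
    using S by (simp add: eq_card_imp_inj_on)
  ultimately show "bij_betw g S V"
    by (simp add: bij_betw_def)
qed

lemma mat_vec_cong:
  assumes "\<And>j. j \<in> J \<Longrightarrow> x j = x' j"
  shows "mat_vec J M x = mat_vec J M x'"
  using assms by (simp add: mat_vec_def)

lemma mat_vec_mat_mult: "mat_vec K (mat_mult J M N) x = mat_vec J M (mat_vec K N x)"
proof
  fix i
  have "mat_vec K (mat_mult J M N) x i = (\<Sum>k\<in>K. \<Sum>j\<in>J. M (i, j) * N (j, k) * x k)"
    by (simp only: mat_vec_def mat_mult_def case_prod_conv sum_distrib_right)
  also have "\<dots> = (\<Sum>j\<in>J. \<Sum>k\<in>K. M (i, j) * (N (j, k) * x k))"
    by (subst sum.swap) (simp only: mult.assoc)
  also have "\<dots> = mat_vec J M (mat_vec K N x) i"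
    by (simp only: mat_vec_def sum_distrib_left)
  finally show "mat_vec K (mat_mult J M N) x i = mat_vec J M (mat_vec K N x) i" .
qed

text \<open>By associativity the system asks for a solution \<open>y\<close> of the form
  \<open>H x\<close>; \<open>restrict\<close> makes it extensional, as \<open>orientations\<close>
  expects.\<close>

lemma solvable_iff_orientations:
  assumes S: "finite S" "card S = n" and q: "q \<in> S \<times> {0, 1} \<rightarrow>\<^sub>E {1..n}"
  shows "solvable n S q H \<longleftrightarrow> (\<exists>x\<in>{1..b_of n} \<rightarrow>\<^sub>E UNIV.
    restrict (mat_vec {1..b_of n} H x) S \<in> orientations n S q)"
proof -
  have "(\<forall>i\<in>{1..n}. mat_vec {1..b_of n} (mat_mult S (A_of q) H) x i = d_of S q i) \<longleftrightarrow>
      restrict (mat_vec {1..b_of n} H x) S \<in> orientations n S q" for x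
  proof -
    define y where "y = restrict (mat_vec {1..b_of n} H x) S"
    have "mat_vec {1..b_of n} (mat_mult S (A_of q) H) x = mat_vec S (A_of q) y"
      unfolding mat_vec_mat_mult y_def by (rule mat_vec_cong) simp
    moreover have "q (j, z) \<in> {1..n}" if "j \<in> S" for j z
      using q that by (cases z) auto
    then have "bij_betw (\<lambda>j. q (j, y j)) S {1..n} \<longleftrightarrow>
        (\<forall>i\<in>{1..n}. odd (card {j \<in> S. q (j, y j) = i}))"
      using S by (intro bij_betw_iff_odd_fibres) auto
    moreover have "y \<in> S \<rightarrow>\<^sub>E UNIV"
      by (simp add: y_def)
    ultimately show ?thesis
      unfolding y_def[symmetric] orientations_def mem_Collect_eq
      by (simp only: mat_vec_A_of_eq_d_of_iff[OF S(1)] simp_thms)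
  qed
  then show ?thesis
    by (simp only: solvable_def)
qed

text \<open>The redirected map fixes every point of \<open>V - W\<close>, so it is a bijection of
  \<open>V\<close> exactly when it maps the remaining set \<open>W\<close> onto itself.\<close>

lemma bij_betw_redirect_iff:
  assumes V: "finite V" and f: "f \<in> V \<rightarrow> V" and W: "W \<subseteq> V"
  shows "bij_betw (\<lambda>v. if v \<in> W then f v else v) V V \<longleftrightarrow> f ` W = W"
proof -
  define \<sigma> where "\<sigma> = (\<lambda>v. if v \<in> W then f v else v)"
  have \<sigma>W: "\<sigma> ` W = f ` W" and \<sigma>V: "\<sigma> ` (V - W) = V - W"
    by (auto simp: \<sigma>_def image_iff)
  have "f ` W = W" if "bij_betw \<sigma> V V"
  proof -
    have "inj_on \<sigma> V" "\<sigma> ` V = V"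
      using that by (auto simp: bij_betw_def)
    then have "\<sigma> ` (V - (V - W)) = V - (V - W)"
      using inj_on_image_set_diff[of \<sigma> V V "V - W"] \<sigma>V by auto
    then show ?thesis
      using W \<sigma>W by (simp add: double_diff)
  qed
  moreover have "bij_betw \<sigma> V V" if "f ` W = W"
  proof -
    have "\<sigma> ` V = \<sigma> ` W \<union> \<sigma> ` (V - W)"
      using W by (simp flip: image_Un add: Un_absorb1)
    also have "\<dots> = V"
      unfolding \<sigma>W \<sigma>V that using W by blast
    finally have "\<sigma> ` V = V" .
    then show ?thesis
      using V by (simp add: bij_betw_def eq_card_imp_inj_on)
  qed
  ultimately show ?thesis
    unfolding \<sigma>_def by blast
qed

section \<open>Orientations of a fixed labelling as invariant sets of its parent map\<close>

definition heads :: "'a set \<Rightarrow> ('a \<times> bit \<Rightarrow> nat) \<Rightarrow> ('a \<Rightarrow> bit) \<Rightarrow> 'a \<Rightarrow> nat" where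
  "heads S q y = (\<lambda>j\<in>S. q (j, y j))"

text \<open>For an orientation \<open>y\<close> exactly one edge \<open>j\<close> has the head
  \<open>v\<close>, and \<open>y j + 1\<close> is its other label, so the value is the tail of the
  edge entering \<open>v\<close>.\<close>

definition parent :: "nat \<Rightarrow> 'a set \<Rightarrow> ('a \<times> bit \<Rightarrow> nat) \<Rightarrow> ('a \<Rightarrow> bit) \<Rightarrow> nat \<Rightarrow> nat" where
  "parent n S q y = (\<lambda>v\<in>{1..n}. let j = inv_into S (heads S q y) v in q (j, y j + 1))"

lemma heads_parent:
  assumes q: "q \<in> S \<times> {0, 1} \<rightarrow>\<^sub>E {1..n}" and y: "y \<in> orientations n S q"
  shows "heads S q y \<in> S \<rightarrow>\<^sub>E {1..n}" "bij_betw (heads S q y) S {1..n}"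
    "parent n S q y \<in> {1..n} \<rightarrow>\<^sub>E {1..n}"
    "\<And>j. j \<in> S \<Longrightarrow> parent n S q y (heads S q y j) = q (j, y j + 1)"
proof -
  have qin: "q (j, z) \<in> {1..n}" if "j \<in> S" for j z
    using q that by (cases z) auto
  then show "heads S q y \<in> S \<rightarrow>\<^sub>E {1..n}"
    by (auto simp: heads_def)
  show bij: "bij_betw (heads S q y) S {1..n}"
    using y unfolding orientations_def heads_def by (simp cong: bij_betw_cong)
  have "inv_into S (heads S q y) v \<in> S" if "v \<in> {1..n}" for v
    using that bij by (metis bij_betw_def inv_into_into)
  then show "parent n S q y \<in> {1..n} \<rightarrow>\<^sub>E {1..n}"
    using qin by (auto simp: parent_def Let_def simp del: atLeastAtMost_iff)
  show "parent n S q y (heads S q y j) = q (j, y j + 1)" if "j \<in> S" for j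
  proof -
    have "inv_into S (heads S q y) (heads S q y j) = j" "heads S q y j \<in> {1..n}"
      using that bij by (auto simp: bij_betw_def simp del: atLeastAtMost_iff)
    then show ?thesis
      by (simp add: parent_def Let_def del: atLeastAtMost_iff)
  qed
qed

text \<open>Reversing a set of edges keeps all in-degrees equal to 1 exactly when the heads of these
  edges are permuted by the parent map.\<close>

lemma card_orientations:
  assumes S: "finite S" and q: "q \<in> S \<times> {0, 1} \<rightarrow>\<^sub>E {1..n}" and y: "y \<in> orientations n S q"
  shows "card (orientations n S q) = card (invs {1..n} (parent n S q y))"
proof -
  let ?V = "{1..n}"
  define g where "g = heads S q y"
  define f where "f = parent n S q y"
  \<comment> \<open>\<open>\<Phi> W\<close> reverses the edges whose heads lie in \<open>W\<close>,
    and \<open>D\<close> recovers the heads of the reversed edges.\<close>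
  define \<Phi> where "\<Phi> = (\<lambda>W. \<lambda>j\<in>S. if g j \<in> W then y j + 1 else y j)"
  define D where "D = (\<lambda>y'. g ` {j \<in> S. y' j \<noteq> y j})"
  note hp = heads_parent[OF q y, folded g_def f_def]
  have inj: "inj_on g S" and gS: "g ` S = ?V"
    using hp(2) by (auto simp: bij_betw_def simp del: atLeastAtMost_iff)
  have flip: "\<Phi> W j \<noteq> y j \<longleftrightarrow> g j \<in> W" if "j \<in> S" for W j
    using that by (cases "y j") (auto simp: \<Phi>_def)
  have D\<Phi>: "D (\<Phi> W) = W" if "W \<subseteq> ?V" for W
  proof -
    have "{j \<in> S. \<Phi> W j \<noteq> y j} = {j \<in> S. g j \<in> W}"
      using flip by (intro Collect_cong conj_cong refl)
    then have "D (\<Phi> W) = g ` {j \<in> S. g j \<in> W}"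
      by (simp only: D_def)
    also have "\<dots> = g ` S \<inter> W"
      by blast
    also have "\<dots> = W"
      unfolding gS using that by (rule Int_absorb1)
    finally show ?thesis .
  qed
  have \<Phi>D: "\<Phi> (D y') = y'" if "y' \<in> S \<rightarrow>\<^sub>E UNIV" for y'
  proof
    fix j
    show "\<Phi> (D y') j = y' j"
    proof (cases "j \<in> S")
      case True
      then have "g j \<in> D y' \<longleftrightarrow> y' j \<noteq> y j"
        using inj unfolding D_def by (auto dest: inj_onD)
      then show ?thesis
        using True by (cases "y j"; cases "y' j") (auto simp: \<Phi>_def)
    next
      case False
      then show ?thesis
        using PiE_arb[OF that False] by (simp add: \<Phi>_def)
    qed
  qed
  \<comment> \<open>A reversed edge has the parent \<open>f (g j)\<close> as its new head, so the
    new heads are given by \<open>?\<sigma>\<close> after the bijection \<open>g\<close>.\<close>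
  have key: "\<Phi> W \<in> orientations n S q \<longleftrightarrow> f ` W = W" if W: "W \<subseteq> ?V" for W
  proof -
    let ?\<sigma> = "\<lambda>v. if v \<in> W then f v else v"
    have "q (j, \<Phi> W j) = (?\<sigma> \<circ> g) j" if "j \<in> S" for j
      using that hp(4)[OF that] by (simp add: \<Phi>_def) (simp add: g_def heads_def)
    then have "bij_betw (\<lambda>j. q (j, \<Phi> W j)) S ?V \<longleftrightarrow> bij_betw (?\<sigma> \<circ> g) S ?V"
      by (intro bij_betw_cong)
    also have "\<dots> \<longleftrightarrow> bij_betw ?\<sigma> ?V ?V"
      by (rule bij_betw_comp_iff[OF hp(2), symmetric])
    also have "\<dots> \<longleftrightarrow> f ` W = W"
      by (rule bij_betw_redirect_iff) (use hp(3) W in auto)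
    finally have "bij_betw (\<lambda>j. q (j, \<Phi> W j)) S ?V \<longleftrightarrow> f ` W = W" .
    moreover have "\<Phi> W \<in> S \<rightarrow>\<^sub>E UNIV"
      by (simp add: \<Phi>_def)
    ultimately show ?thesis
      by (simp only: orientations_def mem_Collect_eq simp_thms)
  qed
  have DV: "D y' \<subseteq> ?V" for y'
    using gS by (auto simp: D_def simp del: atLeastAtMost_iff)
  have ext: "y' \<in> S \<rightarrow>\<^sub>E UNIV" if "y' \<in> orientations n S q" for y'
    using that by (simp only: orientations_def mem_Collect_eq)
  have "bij_betw \<Phi> (invs ?V f) (orientations n S q)"
  proof (rule bij_betw_byWitness[where f' = D])
    show "\<forall>W\<in>invs ?V f. D (\<Phi> W) = W"
      unfolding invs_def using D\<Phi> by blast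
    show "\<forall>y'\<in>orientations n S q. \<Phi> (D y') = y'"
      using \<Phi>D ext by blast
    show "\<Phi> ` invs ?V f \<subseteq> orientations n S q"
      unfolding invs_def using key by blast
    show "D ` orientations n S q \<subseteq> invs ?V f"
    proof (rule image_subsetI)
      fix y' assume y': "y' \<in> orientations n S q"
      then have "\<Phi> (D y') \<in> orientations n S q"
        by (simp only: \<Phi>D[OF ext[OF y']])
      then show "D y' \<in> invs ?V f"
        using key[OF DV] DV by (simp add: invs_def)
    qed
  qed
  then show ?thesis
    by (simp add: bij_betw_same_card f_def)
qed

section \<open>Double counting of labellings and orientations\<close>

definition labelled_bijections :: "nat \<Rightarrow> 'a set \<Rightarrow> (('a \<Rightarrow> bit) \<times> ('a \<Rightarrow> nat)) set" where
  "labelled_bijections n S =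
    {(y, g). y \<in> S \<rightarrow>\<^sub>E UNIV \<and> g \<in> S \<rightarrow>\<^sub>E {1..n} \<and> bij_betw g S {1..n}}"

lemma finite_orientations: "finite S \<Longrightarrow> finite (orientations n S q)"
  unfolding orientations_def using finite_bit_functions by (rule rev_finite_subset) auto

lemma finite_labelled_bijections:
  assumes "finite S"
  shows "finite (labelled_bijections n S)"
  by (rule finite_subset[of _ "(S \<rightarrow>\<^sub>E UNIV) \<times> (S \<rightarrow>\<^sub>E {1..n})"])
    (use assms in \<open>auto simp: labelled_bijections_def finite_bit_functions finite_PiE\<close>)

lemma labelled_bijections_nonempty:
  assumes "finite S" "card S = n"
  shows "labelled_bijections n S \<noteq> {}"
proof -
  obtain g where g: "bij_betw g S {1..n}"
    using finite_same_card_bij[of S "{1..n}"] assms by auto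
  have "bij_betw (restrict g S) S {1..n}"
    using g by (simp cong: bij_betw_cong)
  moreover have "restrict g S \<in> S \<rightarrow>\<^sub>E {1..n}"
    using bij_betw_imp_funcset[OF g] by auto
  moreover have "(\<lambda>j\<in>S. 0) \<in> S \<rightarrow>\<^sub>E (UNIV :: bit set)"
    by simp
  ultimately show ?thesis
    unfolding labelled_bijections_def by blast
qed

text \<open>An edge labelling together with an orientation is a bijection from edges to heads together
  with an arbitrary parent map.\<close>

lemma sum_orientations:
  fixes \<phi> :: "nat \<Rightarrow> real"
  assumes S: "finite S"
  shows "(\<Sum>q\<in>S \<times> {0, 1} \<rightarrow>\<^sub>E {1..n}. \<Sum>y\<in>orientations n S q. \<phi> (card (orientations n S q))) =
    real (card (labelled_bijections n S)) * (\<Sum>f\<in>{1..n} \<rightarrow>\<^sub>E {1..n}. \<phi> (card (invs {1..n} f)))"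
proof -
  let ?V = "{1..n}" and ?Q = "S \<times> {0, 1} \<rightarrow>\<^sub>E {1..n}"
  define P where "P = (SIGMA q : ?Q. orientations n S q)"
  define T where "T = labelled_bijections n S \<times> (?V \<rightarrow>\<^sub>E ?V)"
  define fw where "fw = (\<lambda>(q, y). ((y, heads S q y), parent n S q y))"
  \<comment> \<open>The end with label \<open>y j\<close> becomes the head \<open>g j\<close>, and
    the end with the other label becomes the parent of that head.\<close>
  define bw :: "(('a \<Rightarrow> bit) \<times> ('a \<Rightarrow> nat)) \<times> (nat \<Rightarrow> nat) \<Rightarrow> ('a \<times> bit \<Rightarrow> nat) \<times> ('a \<Rightarrow> bit)"
    where "bw = (\<lambda>((y, g), f).
      (\<lambda>p\<in>S \<times> {0, 1}. if snd p = y (fst p) then g (fst p) else f (g (fst p)), y))"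
  have bit01: "x \<in> {0, 1}" for x :: bit
    by (cases x) auto
  have finQ: "finite ?Q"
    using S by (intro finite_PiE) auto
  have "(\<Sum>q\<in>?Q. \<Sum>y\<in>orientations n S q. \<phi> (card (orientations n S q)))
      = (\<Sum>(q, y)\<in>P. \<phi> (card (orientations n S q)))"
    unfolding P_def by (rule sum.Sigma) (use finQ finite_orientations[OF S] in auto)
  also have "\<dots> = (\<Sum>(c, f)\<in>T. \<phi> (card (invs ?V f)))"
  proof (rule sum.reindex_bij_witness[where i = bw and j = fw])
    fix p assume "p \<in> P"
    then obtain q y where p: "p = (q, y)" and q: "q \<in> ?Q" and y: "y \<in> orientations n S q"
      unfolding P_def by blast
    note hp = heads_parent[OF q y]
    show "fw p \<in> T"
      using hp(1-3) y by (simp add: p fw_def T_def labelled_bijections_def orientations_def)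
    show "(case fw p of (c, f) \<Rightarrow> \<phi> (card (invs ?V f))) = (case p of (q, y) \<Rightarrow> \<phi> (card (orientations n S q)))"
      using card_orientations[OF S q y] by (simp add: p fw_def)
    have "(\<lambda>p\<in>S \<times> {0, 1}. if snd p = y (fst p) then heads S q y (fst p)
        else parent n S q y (heads S q y (fst p))) = q" (is "?q = q")
    proof
      fix p
      show "?q p = q p"
      proof (cases "p \<in> S \<times> {0, 1}")
        case True
        then obtain j x where jx: "p = (j, x)" "j \<in> S"
          by blast
        have "x = y j \<or> x = y j + 1"
          by (cases x; cases "y j") auto
        then show ?thesis
          using True jx hp(4)[OF jx(2)] by (auto simp: heads_def)
      next
        case False
        then show ?thesis
          using PiE_arb[OF q False] by (simp only: restrict_def if_False)
      qed
    qed
    then show "bw (fw p) = p"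
      by (simp add: p fw_def bw_def)
  next
    fix t assume "t \<in> T"
    then obtain y g f where t: "t = ((y, g), f)" and y: "y \<in> S \<rightarrow>\<^sub>E UNIV" and g: "g \<in> S \<rightarrow>\<^sub>E ?V"
      "bij_betw g S ?V" and f: "f \<in> ?V \<rightarrow>\<^sub>E ?V"
      unfolding T_def labelled_bijections_def by blast
    define q where "q = (\<lambda>p\<in>S \<times> {0, 1}. if snd p = y (fst p) then g (fst p) else f (g (fst p)))"
    have bwt: "bw t = (q, y)"
      by (simp add: t bw_def q_def)
    have q1: "q (j, y j) = g j" "q (j, y j + 1) = f (g j)" if "j \<in> S" for j
      using that bit01[of "y j"] bit01[of "y j + 1"] by (simp_all add: q_def del: insert_iff)
    have qQ: "q \<in> ?Q"
      using g f by (auto simp: q_def PiE_iff simp del: atLeastAtMost_iff)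
    have heads: "heads S q y = g"
      using q1(1) g(1) by (auto simp: heads_def fun_eq_iff PiE_iff extensional_def)
    have "bij_betw (\<lambda>j. q (j, y j)) S ?V"
      using g(2) q1(1) by (simp cong: bij_betw_cong)
    then have yO: "y \<in> orientations n S q"
      using y by (simp add: orientations_def)
    show "bw t \<in> P"
      using qQ yO by (simp add: bwt P_def)
    have "parent n S q y v = f v" for v
    proof (cases "v \<in> ?V")
      case True
      then obtain j where "j \<in> S" "v = g j"
        using g(2) unfolding bij_betw_def by blast
      then show ?thesis
        using heads_parent(4)[OF qQ yO] q1(2) heads by simp
    next
      case False
      then show ?thesis
        using PiE_arb[OF f False] by (simp only: parent_def restrict_def if_False)
    qed
    then have "parent n S q y = f"
      by (rule ext)
    then show "fw (bw t) = t"
      unfolding bwt by (simp add: fw_def heads t)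
  qed
  also have "\<dots> = (\<Sum>c\<in>labelled_bijections n S. \<Sum>f\<in>?V \<rightarrow>\<^sub>E ?V. \<phi> (card (invs ?V f)))"
    unfolding T_def by (rule sum.cartesian_product[symmetric])
  also have "\<dots> = real (card (labelled_bijections n S)) * (\<Sum>f\<in>?V \<rightarrow>\<^sub>E ?V. \<phi> (card (invs ?V f)))"
    by (rule sum_constant)
  finally show ?thesis .
qed

section \<open>The main estimate\<close>

text \<open>The moment of order \<open>s\<close> of 1/N for a uniform self-map, up to the factor
  \<open>n ^ n\<close>. Summing over orientations counts each labelling N times and uses up one
  power, so up to a common factor orders 1 and 2 give the number of pseudoforests and the sum of 1/N
  over them.\<close>

definition map_moment :: "nat \<Rightarrow> nat \<Rightarrow> real" where
  "map_moment n s = (\<Sum>f\<in>{1..n} \<rightarrow>\<^sub>E {1..n}. (1 / real (card (invs {1..n} f))) ^ s)"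

lemma map_moment_eq:
  assumes "n > 0"
  shows "map_moment n s = real n ^ n *
    (\<Sum>k\<le>n. (no_collision n k - no_collision n (Suc k)) * (pochhammer (1 / 2 ^ s) k / fact k))"
  unfolding map_moment_def weighted_sum_no_collision[OF assms, symmetric]
  by (rule sum_maps_card_invs) (use assms in auto)

lemma map_moment_1_ge:
  assumes "n > 0"
  shows "real n ^ n * (real n powr (- 1/4) / 12) \<le> map_moment n 1"
  unfolding map_moment_eq[OF assms] using weighted_sum_half_ge[OF assms]
  by (intro mult_left_mono) simp_all

lemma map_moment_2_le:
  assumes "n > 0"
  shows "map_moment n 2 \<le> real n ^ n * (5 * real n powr (- 3/8))"
  unfolding map_moment_eq[OF assms] using weighted_sum_quarter_le[OF assms]
  by (intro mult_left_mono) simp_all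

text \<open>As ln n lies between 0 and n - 1, \<open>b_of n\<close> is positive and at most
  \<open>n\<close>. The last bound follows from 2 < e and n - b \<le> (ln n) / 9.\<close>

lemma b_of_bounds:
  assumes "n > 0"
  shows "0 < b_of n" "b_of n \<le> n" "2 ^ (n - b_of n) \<le> real n powr (1/9)"
proof -
  have ln: "0 \<le> ln (real n)" "ln (real n) \<le> real n - 1"
    using assms ln_le_minus_one[of "real n"] by auto
  then have pos: "0 < real n - 1 / 9 * ln (real n)"
    using assms by linarith
  then show "0 < b_of n"
    by (simp add: b_of_def)
  show le: "b_of n \<le> n"
    unfolding b_of_def using ln by (simp add: nat_le_iff ceiling_le_iff)
  have "real n - 1 / 9 * ln (real n) \<le> real (b_of n)"
    unfolding b_of_def using pos by linarith
  then have "real (n - b_of n) \<le> 1 / 9 * ln (real n)"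
    using le by simp
  then have "exp (real (n - b_of n)) \<le> real n powr (1/9)"
    using assms by (simp add: powr_def)
  moreover have "(2::real) ^ (n - b_of n) \<le> exp 1 ^ (n - b_of n)"
    using exp_ge_add_one_self[of 1] by (intro power_mono) auto
  ultimately show "2 ^ (n - b_of n) \<le> real n powr (1/9)"
    by (simp flip: exp_of_nat_mult)
qed

text \<open>The exponent 1/9 - 3/8 = -19/72 is smaller than -1/4 = -18/72, so the left side is
  eventually dominated.\<close>

lemma eventually_map_moment:
  "eventually (\<lambda>n. 2 * (2 ^ (n - b_of n) * map_moment n 2) \<le> map_moment n 1) sequentially"
proof -
  \<comment> \<open>The constant is 2 * 5 * 12, from the claim and the two moment bounds.\<close>
  have "eventually (\<lambda>n. 120 * real n powr (1/9 - 3/8) \<le> real n powr (- 1/4)) sequentially"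
    by real_asymp
  moreover have "eventually (\<lambda>n::nat. n > 0) sequentially"
    by (rule eventually_gt_at_top)
  ultimately show ?thesis
  proof eventually_elim
    case (elim n)
    have M2: "0 \<le> map_moment n 2"
      unfolding map_moment_def by (intro sum_nonneg) simp
    have "2 ^ (n - b_of n) * map_moment n 2 \<le> real n powr (1/9) * map_moment n 2"
      using b_of_bounds(3)[OF elim(2)] M2 by (rule mult_right_mono)
    also have "\<dots> \<le> real n powr (1/9) * (real n ^ n * (5 * real n powr (- 3/8)))"
      using map_moment_2_le[OF elim(2)] by (intro mult_left_mono) auto
    also have "\<dots> = real n ^ n * 5 * (real n powr (1/9) * real n powr (- 3/8))"
      by (simp only: mult_ac)
    also have "real n powr (1/9) * real n powr (- 3/8) = real n powr (1/9 - 3/8)"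
      by (simp flip: powr_add)
    also have "real n ^ n * 5 * real n powr (1/9 - 3/8) \<le> real n ^ n * (real n powr (- 1/4) / 24)"
      using mult_left_mono[OF elim(1), of "real n ^ n / 24"] by simp
    finally have "2 * (2 ^ (n - b_of n) * map_moment n 2) \<le> real n ^ n * (real n powr (- 1/4) / 12)"
      by simp
    also have "\<dots> \<le> map_moment n 1"
      by (rule map_moment_1_ge[OF elim(2)])
    finally show ?case .
  qed
qed

text \<open>A Markov argument: a pseudoforest with too few orientations contributes at least 1 to
  the sum of \<open>2 ^ (n - b_of n) / N q\<close>. By the moment inequality this sum is at most
  half the number of pseudoforests.\<close>

lemma card_good_pseudoforests:
  fixes S :: "'a set"
  assumes S: "finite S" "card S = n" and n: "n > 0"
    and mom: "2 * (2 ^ (n - b_of n) * map_moment n 2) \<le> map_moment n 1"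
  defines "Q \<equiv> S \<times> {0, 1} \<rightarrow>\<^sub>E {1..n}"
  shows "0 < card {q \<in> Q. pseudoforest (G_of n S q)}"
    "real (card {q \<in> Q. pseudoforest (G_of n S q)}) \<le>
      2 * real (card {q \<in> Q. pseudoforest (G_of n S q) \<and> 2 ^ n \<le> 2 ^ b_of n * card (orientations n S q)})"
proof -
  define PF where "PF = {q \<in> Q. pseudoforest (G_of n S q)}"
  define good where "good = (\<lambda>q. 2 ^ n \<le> 2 ^ b_of n * card (orientations n S q))"
  define N where "N = (\<lambda>q. real (card (orientations n S q)))"
  define c where "c = real (card (labelled_bijections n S))"
  have finQ: "finite Q"
    unfolding Q_def using S by (intro finite_PiE) auto
  have pf: "pseudoforest (G_of n S q) \<longleftrightarrow> N q \<noteq> 0" if "q \<in> Q" for q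
    using that pseudoforest_iff_orientations[OF S] finite_orientations[OF S(1)]
    unfolding Q_def N_def by simp
  have moment: "(\<Sum>q\<in>Q. \<Sum>y\<in>orientations n S q. (1 / N q) ^ s) = c * map_moment n s" for s
    using sum_orientations[OF S(1), where n = n and \<phi> = "\<lambda>k. (1 / real k) ^ s"]
    unfolding Q_def N_def c_def map_moment_def by simp
  \<comment> \<open>The inner sum has \<open>N q\<close> equal terms, which cancels one power of
    \<open>1 / N q\<close>; labellings without orientation contribute 0.\<close>
  have sum_pf: "(\<Sum>q\<in>Q. \<Sum>y\<in>orientations n S q. (1 / N q) ^ Suc s) = (\<Sum>q\<in>PF. (1 / N q) ^ s)" for s
  proof -
    have "(\<Sum>q\<in>Q. \<Sum>y\<in>orientations n S q. (1 / N q) ^ Suc s) = (\<Sum>q\<in>Q. N q * (1 / N q) ^ Suc s)"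
      by (simp add: N_def)
    also have "\<dots> = (\<Sum>q\<in>PF. N q * (1 / N q) ^ Suc s)"
      by (rule sum.mono_neutral_right) (use finQ pf in \<open>auto simp: PF_def\<close>)
    also have "\<dots> = (\<Sum>q\<in>PF. (1 / N q) ^ s)"
      by (intro sum.cong refl) (use pf in \<open>auto simp: PF_def\<close>)
    finally show ?thesis .
  qed
  have card_PF: "real (card PF) = c * map_moment n 1"
    using sum_pf[of 0] moment[of 1] by simp
  have "c > 0"
    unfolding c_def using labelled_bijections_nonempty[OF S] finite_labelled_bijections[OF S(1)]
    by (simp add: card_gt_0_iff)
  moreover have "0 < real n ^ n * (real n powr (- 1/4) / 12)"
    using n by simp
  then have "0 < map_moment n 1"
    using map_moment_1_ge[OF n] by linarith
  ultimately have "0 < real (card PF)"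
    unfolding card_PF by simp
  then show "0 < card {q \<in> Q. pseudoforest (G_of n S q)}"
    unfolding PF_def by simp
  have finPF: "finite PF"
    using finQ by (simp add: PF_def)
  have "real (card {q \<in> PF. \<not> good q}) = (\<Sum>q\<in>{q \<in> PF. \<not> good q}. 1)"
    by simp
  also have "\<dots> \<le> (\<Sum>q\<in>{q \<in> PF. \<not> good q}. 2 ^ (n - b_of n) * (1 / N q))"
  proof (rule sum_mono)
    fix q assume q: "q \<in> {q \<in> PF. \<not> good q}"
    then have "0 < N q"
      using pf by (auto simp: PF_def N_def)
    moreover have "2 ^ b_of n * N q \<le> 2 ^ b_of n * 2 ^ (n - b_of n)"
    proof -
      have "2 ^ b_of n * card (orientations n S q) \<le> 2 ^ n"
        using q by (simp add: good_def)
      then have "real (2 ^ b_of n * card (orientations n S q)) \<le> real (2 ^ n)"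
        by (simp only: of_nat_le_iff)
      then show ?thesis
        using b_of_bounds(2)[OF n] by (simp add: N_def flip: power_add)
    qed
    then have "N q \<le> 2 ^ (n - b_of n)"
      by (rule mult_left_le_imp_le) simp
    ultimately show "1 \<le> 2 ^ (n - b_of n) * (1 / N q)"
      by (simp add: field_simps)
  qed
  also have "\<dots> \<le> (\<Sum>q\<in>PF. 2 ^ (n - b_of n) * (1 / N q))"
    by (rule sum_mono2) (use finPF in \<open>auto simp: N_def\<close>)
  also have "\<dots> = c * (2 ^ (n - b_of n) * map_moment n 2)"
    using sum_pf[of 1] moment[of 2]
    by (simp add: numeral_2_eq_2 sum_distrib_left[symmetric] del: times_divide_eq_right mult_1_right)
  finally have "2 * real (card {q \<in> PF. \<not> good q}) \<le> c * (2 * (2 ^ (n - b_of n) * map_moment n 2))"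
    by simp
  also have "\<dots> \<le> real (card PF)"
    unfolding card_PF using mom \<open>c > 0\<close> by (intro mult_left_mono) auto
  finally have bad: "2 * real (card {q \<in> PF. \<not> good q}) \<le> real (card PF)" .
  have "PF = {q \<in> PF. good q} \<union> {q \<in> PF. \<not> good q}"
    by blast
  then have "card PF = card {q \<in> PF. good q} + card {q \<in> PF. \<not> good q}"
    using finPF by (subst card_Un_disjoint[symmetric]) auto
  then have "real (card PF) \<le> 2 * real (card {q \<in> PF. good q})"
    using bad by simp
  then show "real (card {q \<in> Q. pseudoforest (G_of n S q)}) \<le>
      2 * real (card {q \<in> Q. pseudoforest (G_of n S q) \<and> 2 ^ n \<le> 2 ^ b_of n * card (orientations n S q)})"
    by (simp add: PF_def good_def conj_assoc)
qed

section \<open>From counts to the conditional probability\<close>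

lemma pair_pmf_of_set_eq:
  assumes "finite A" "A \<noteq> {}" "finite B" "B \<noteq> {}"
  shows "pair_pmf (pmf_of_set A) (pmf_of_set B) = pmf_of_set (A \<times> B)"
proof (rule pmf_eqI)
  fix p
  show "pmf (pair_pmf (pmf_of_set A) (pmf_of_set B)) p = pmf (pmf_of_set (A \<times> B)) p"
    using assms by (cases p) (simp add: pmf_pair indicator_def card_cartesian_product)
qed

text \<open>At least half of the pseudoforests have enough orientations, and for each of these at
  least a third of all \<open>H\<close> admit a solution, whence 1/6.\<close>

lemma cond_prob_solvable_ge:
  fixes S :: "'a set"
  assumes S: "finite S" "card S = n" and n: "n > 0"
    and mom: "2 * (2 ^ (n - b_of n) * map_moment n 2) \<le> map_moment n 1"
  shows "1/6 \<le> \<P>((q, H) in measure_pmf (qH_pmf n S). solvable n S q H \<bar> pseudoforest (G_of n S q))"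
proof -
  define Q where "Q = S \<times> {0, 1 :: bit} \<rightarrow>\<^sub>E {1..n}"
  define \<H> where "\<H> = S \<times> {1..b_of n} \<rightarrow>\<^sub>E (UNIV :: bit set)"
  define PF where "PF = {q \<in> Q. pseudoforest (G_of n S q)}"
  define good where "good = {q \<in> Q. pseudoforest (G_of n S q) \<and> 2 ^ n \<le> 2 ^ b_of n * card (orientations n S q)}"
  have Q: "finite Q" "Q \<noteq> {}"
    unfolding Q_def using S n by (auto intro!: finite_PiE simp: PiE_eq_empty_iff)
  have H: "finite \<H>" "\<H> \<noteq> {}"
    unfolding \<H>_def using S by (auto intro!: finite_bit_functions simp: PiE_eq_empty_iff)
  have pmf: "qH_pmf n S = pmf_of_set (Q \<times> \<H>)"
    unfolding qH_pmf_def Q_def[symmetric] \<H>_def[symmetric] by (rule pair_pmf_of_set_eq[OF Q H])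
  have prob: "measure (measure_pmf (qH_pmf n S)) A = real (card (Q \<times> \<H> \<inter> A)) / real (card (Q \<times> \<H>))" for A
    unfolding pmf by (rule measure_pmf_of_set) (use Q H in auto)
  \<comment> \<open>Under the uniform law on the product set the conditional probability is a
    quotient of two counts, whose sets are identified here and in \<open>num\<close>.\<close>
  have den: "Q \<times> \<H> \<inter> {p. case p of (q, H) \<Rightarrow> pseudoforest (G_of n S q)} = PF \<times> \<H>"
    by (auto simp: PF_def)
  have num: "Q \<times> \<H> \<inter> {p. (case p of (q, H) \<Rightarrow> solvable n S q H) \<and> (case p of (q, H) \<Rightarrow> pseudoforest (G_of n S q))}
      = (SIGMA q : PF. {H \<in> \<H>. solvable n S q H})"
    by (auto simp: PF_def)
  have hit: "real (card \<H>) \<le> 3 * real (card {H \<in> \<H>. solvable n S q H})" if "q \<in> good" for q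
  proof -
    have q: "q \<in> S \<times> {0, 1} \<rightarrow>\<^sub>E {1..n}" "2 ^ card S \<le> 2 ^ card {1..b_of n} * card (orientations n S q)"
      using that S(2) by (auto simp: good_def Q_def)
    have "orientations n S q \<subseteq> S \<rightarrow>\<^sub>E UNIV"
      by (auto simp: orientations_def)
    then show ?thesis
      using card_matrices_hitting[OF S(1), of "{1..b_of n}" "orientations n S q"] q(2) b_of_bounds(1)[OF n]
      unfolding \<H>_def solvable_iff_orientations[OF S q(1)] by auto
  qed
  have goodPF: "good \<subseteq> PF" and finPF: "finite PF"
    using Q by (auto simp: good_def PF_def)
  have PF: "0 < card PF" "real (card PF) \<le> 2 * real (card good)"
    using card_good_pseudoforests[OF S n mom] by (simp_all add: PF_def good_def Q_def)
  have "real (card PF) * real (card \<H>) \<le> 2 * (real (card good) * real (card \<H>))"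
    using PF(2) by (simp add: mult_right_mono flip: mult.assoc)
  also have "real (card good) * real (card \<H>) = (\<Sum>q\<in>good. real (card \<H>))"
    by simp
  also have "\<dots> \<le> (\<Sum>q\<in>good. 3 * real (card {H \<in> \<H>. solvable n S q H}))"
    by (rule sum_mono) (rule hit)
  also have "\<dots> \<le> (\<Sum>q\<in>PF. 3 * real (card {H \<in> \<H>. solvable n S q H}))"
    by (rule sum_mono2[OF finPF goodPF]) simp
  also have "\<dots> = 3 * real (card (SIGMA q : PF. {H \<in> \<H>. solvable n S q H}))"
    using finPF H(1) by (simp add: card_SigmaI flip: sum_distrib_left)
  finally have "real (card (PF \<times> \<H>)) \<le> 6 * real (card (SIGMA q : PF. {H \<in> \<H>. solvable n S q H}))"
    by (simp add: card_cartesian_product)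
  moreover have "0 < real (card (PF \<times> \<H>))"
    using PF(1) H by (simp add: card_cartesian_product card_gt_0_iff)
  moreover have "0 < real (card (Q \<times> \<H>))"
    using Q H by (simp add: card_cartesian_product card_gt_0_iff)
  ultimately show ?thesis
    unfolding cond_prob_def by (simp add: prob num den field_simps del: card_cartesian_product)
qed

theorem theorem4p17:
  fixes S :: "nat \<Rightarrow> 'a set"
  assumes "\<And>n. finite (S n)" and "\<And>n. card (S n) = n"
  shows "(\<lambda>n. \<P>((q, H) in measure_pmf (qH_pmf n (S n)).
              solvable n (S n) q H \<bar> pseudoforest (G_of n (S n) q))) \<in> \<Omega>(\<lambda>n. 1)"
proof (rule landau_omega.bigI[where c = "1/6"])
  show "eventually (\<lambda>n. 1/6 * norm (1 :: real) \<le> norm (\<P>((q, H) in measure_pmf (qH_pmf n (S n)).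
              solvable n (S n) q H \<bar> pseudoforest (G_of n (S n) q)))) sequentially"
    using eventually_map_moment eventually_gt_at_top[of "0 :: nat"]
  proof eventually_elim
    case (elim n)
    show ?case
      using cond_prob_solvable_ge[OF assms elim(2,1)] by simp
  qed
qed simp

end
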